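(* Let $T$ be a (connected) abelian Lie group, with Lie algebra $\mathfrak t$, acting nontrivially by triholomorphic isometries on a connected hyper-Kähler manifold $M$ with zero first Betti number. Then, for any admissible Kähler structure $J$ on $M$, the moment map $M\to\mathfrak t^*$ of the action with respect to the Kähler form of $J$ is a harmonic map.
   Context: Let $(g,J_1,J_2,J_3)$ be the hyper-Kähler structure of $M$ ($g$ is Kähler with respect to each $J_j$, and $J_1J_2=J_3=-J_2J_1$). A Kähler structure $J$ on $(M,g)$ is called admissible if $J=q^1J_1+q^2J_2+q^3J_3$ for some $q=(q^1,q^2,q^3)\in S^2\subseteq\mathrm{Im}\,\mathbb H=\mathbb R^3$. An isometry is triholomorphic if it is holomorphic with respect to each of $J_1,J_2,J_3$. The Kähler form of $J$ is $\omega(X,Y)=g(JX,Y)$. The Hamiltonian of a vector field $V$ with respect to $\omega$ is a function $f$ with $df=\omega(V,\cdot)$ (overall sign convention immaterial, unique up to an additive constant). The moment map with respect to $\omega$ is the map $\phi:M\to\mathfrak t^*$ such that, for each $v\in\mathfrak t$, $x\mapsto\phi(x)(v)$ is the Hamiltonian of the fundamental vector field on $M$ induced by $v$. Harmonicity is with respect to $g$ and the flat structure of the vector space $\mathfrak t^*$, i.e. every component function $x\mapsto \phi(x)(v)$ is harmonic on $(M,g)$. An action is nontrivial if it has at least one orbit that is not a fixed point. *)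

theory Defs
  imports "HOL-Analysis.Analysis" "HOL-Library.Extended_Nat"
begin

section \<open>Smooth functions between Euclidean spaces\<close>

(* Only used on open sets. *)
fun Ck_on :: "nat \<Rightarrow> 'a::real_normed_vector set \<Rightarrow> ('a \<Rightarrow> 'b::real_normed_vector) \<Rightarrow> bool" where
  "Ck_on 0 S f \<longleftrightarrow> continuous_on S f"
| "Ck_on (Suc k) S f \<longleftrightarrow>
     (\<forall>x\<in>S. f differentiable (at x)) \<and>
     (\<forall>v. Ck_on k S (\<lambda>x. frechet_derivative f (at x) v))"

definition smooth_on :: "'a::real_normed_vector set \<Rightarrow> ('a \<Rightarrow> 'b::real_normed_vector) \<Rightarrow> bool" where
  "smooth_on S f \<longleftrightarrow> (\<forall>k. Ck_on k S f)"


section \<open>Smooth manifolds\<close>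

(* A manifold is a whole type, with a smooth atlas. The model space is a Euclidean space 'e, so
   the dimension is DIM('e). A chart is a pair (domain, coordinate map). *)
type_synonym ('m, 'e) chart = "'m set \<times> ('m \<Rightarrow> 'e)"

abbreviation chart_inv :: "('m, 'e) chart \<Rightarrow> 'e \<Rightarrow> 'm" where
  "chart_inv c \<equiv> inv_into (fst c) (snd c)"

abbreviation chart_image :: "('m, 'e) chart \<Rightarrow> 'e set" where
  "chart_image c \<equiv> snd c ` fst c"

definition is_chart :: "('m::topological_space, 'e::euclidean_space) chart \<Rightarrow> bool" where
  "is_chart c \<longleftrightarrow> open (fst c) \<and> open (chart_image c) \<and>
     homeomorphism (fst c) (chart_image c) (snd c) (chart_inv c)"

definition smooth_atlas ::
  "('m::{second_countable_topology,t2_space}, 'e::euclidean_space) chart set \<Rightarrow> bool" where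
  "smooth_atlas A \<longleftrightarrow>
     (\<forall>c\<in>A. is_chart c) \<and> (\<Union>c\<in>A. fst c) = UNIV \<and>
     (\<forall>c\<in>A. \<forall>d\<in>A. smooth_on (snd c ` (fst c \<inter> fst d)) (snd d \<circ> chart_inv c))"

definition prod_atlas ::
  "('m, 'e) chart set \<Rightarrow> ('n, 'f) chart set \<Rightarrow> ('m \<times> 'n, 'e \<times> 'f) chart set" where
  "prod_atlas A B = {(fst c \<times> fst d, map_prod (snd c) (snd d)) | c d. c \<in> A \<and> d \<in> B}"

definition smooth_map ::
  "('m::topological_space, 'e::euclidean_space) chart set \<Rightarrow>
   ('n::topological_space, 'f::euclidean_space) chart set \<Rightarrow> ('m \<Rightarrow> 'n) \<Rightarrow> bool" where
  "smooth_map A B f \<longleftrightarrow> continuous_on UNIV f \<and>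
     (\<forall>c\<in>A. \<forall>d\<in>B. smooth_on (snd c ` (fst c \<inter> f -` fst d)) (snd d \<circ> f \<circ> chart_inv c))"

definition smooth_fun :: "('m, 'e::euclidean_space) chart set \<Rightarrow> ('m \<Rightarrow> real) \<Rightarrow> bool" where
  "smooth_fun A f \<longleftrightarrow> (\<forall>c\<in>A. smooth_on (chart_image c) (f \<circ> chart_inv c))"


section \<open>Tangent vectors and tensor fields\<close>

(* At every point x one chart of the atlas around x is selected, and the tangent space at x is
   the model space 'e, read in the coordinates of that chart. Hence a vector field is a function
   'm => 'e, an endomorphism field a function 'm => 'e => 'e, a bilinear form field a function
   'm => 'e => 'e => real. The selected chart varies discontinuously with x, so smoothness and
   differential operators are always expressed through the components in a fixed chart. *)
definition chart_at :: "('m, 'e) chart set \<Rightarrow> 'm \<Rightarrow> ('m, 'e) chart" where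
  "chart_at A x = (SOME c. c \<in> A \<and> x \<in> fst c)"

definition tangent_map ::
  "('m, 'e::euclidean_space) chart set \<Rightarrow> ('n, 'f::euclidean_space) chart set \<Rightarrow>
   ('m \<Rightarrow> 'n) \<Rightarrow> 'm \<Rightarrow> 'e \<Rightarrow> 'f" where
  "tangent_map A B f x =
     frechet_derivative (snd (chart_at B (f x)) \<circ> f \<circ> chart_inv (chart_at A x))
       (at (snd (chart_at A x) x))"

definition differential ::
  "('m, 'e::euclidean_space) chart set \<Rightarrow> ('m \<Rightarrow> real) \<Rightarrow> 'm \<Rightarrow> 'e \<Rightarrow> real" where
  "differential A f x =
     frechet_derivative (f \<circ> chart_inv (chart_at A x)) (at (snd (chart_at A x) x))"

(* Passage from components in the chart c to tangent vectors at x, and back. *)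
definition from_coords ::
  "('m, 'e::euclidean_space) chart set \<Rightarrow> ('m, 'e) chart \<Rightarrow> 'm \<Rightarrow> 'e \<Rightarrow> 'e" where
  "from_coords A c x = frechet_derivative (snd (chart_at A x) \<circ> chart_inv c) (at (snd c x))"

definition to_coords ::
  "('m, 'e::euclidean_space) chart set \<Rightarrow> ('m, 'e) chart \<Rightarrow> 'm \<Rightarrow> 'e \<Rightarrow> 'e" where
  "to_coords A c x =
     frechet_derivative (snd c \<circ> chart_inv (chart_at A x)) (at (snd (chart_at A x) x))"

definition local_1form ::
  "('m, 'e::euclidean_space) chart set \<Rightarrow> ('m, 'e) chart \<Rightarrow> ('m \<Rightarrow> 'e \<Rightarrow> real) \<Rightarrow>
   'e \<Rightarrow> 'e \<Rightarrow> real" where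
  "local_1form A c \<alpha> y v = (let x = chart_inv c y in \<alpha> x (from_coords A c x v))"

definition local_bilinear ::
  "('m, 'e::euclidean_space) chart set \<Rightarrow> ('m, 'e) chart \<Rightarrow> ('m \<Rightarrow> 'e \<Rightarrow> 'e \<Rightarrow> real) \<Rightarrow>
   'e \<Rightarrow> 'e \<Rightarrow> 'e \<Rightarrow> real" where
  "local_bilinear A c g y v w =
     (let x = chart_inv c y in g x (from_coords A c x v) (from_coords A c x w))"

definition local_endo ::
  "('m, 'e::euclidean_space) chart set \<Rightarrow> ('m, 'e) chart \<Rightarrow> ('m \<Rightarrow> 'e \<Rightarrow> 'e) \<Rightarrow>
   'e \<Rightarrow> 'e \<Rightarrow> 'e" where
  "local_endo A c J y v = (let x = chart_inv c y in to_coords A c x (J x (from_coords A c x v)))"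


section \<open>First Betti number\<close>

definition closed_1form ::
  "('m, 'e::euclidean_space) chart set \<Rightarrow> ('m \<Rightarrow> 'e \<Rightarrow> real) \<Rightarrow> bool" where
  "closed_1form A \<alpha> \<longleftrightarrow>
     (\<forall>x. linear (\<alpha> x)) \<and>
     (\<forall>c\<in>A. \<forall>v. smooth_on (chart_image c) (\<lambda>y. local_1form A c \<alpha> y v)) \<and>
     (\<forall>c\<in>A. \<forall>y\<in>chart_image c. \<forall>v w.
        frechet_derivative (\<lambda>y. local_1form A c \<alpha> y w) (at y) v =
        frechet_derivative (\<lambda>y. local_1form A c \<alpha> y v) (at y) w)"

definition exact_1form ::
  "('m, 'e::euclidean_space) chart set \<Rightarrow> ('m \<Rightarrow> 'e \<Rightarrow> real) \<Rightarrow> bool" where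
  "exact_1form A \<alpha> \<longleftrightarrow> (\<exists>f. smooth_fun A f \<and> \<alpha> = differential A f)"

(* Dimension (possibly infinite) of the de Rham cohomology H^1 = closed forms / exact forms: the
   supremum of the sizes of finite sets of closed forms linearly independent modulo exact ones. *)
definition first_betti_number :: "('m, 'e::euclidean_space) chart set \<Rightarrow> enat" where
  "first_betti_number A =
     (SUP S \<in> {S. finite S \<and> (\<forall>\<alpha>\<in>S. closed_1form A \<alpha>) \<and>
                 (\<forall>a. exact_1form A (\<lambda>x v. \<Sum>\<alpha>\<in>S. a \<alpha> * \<alpha> x v) \<longrightarrow> (\<forall>\<alpha>\<in>S. a \<alpha> = 0))}.
        enat (card S))"


section \<open>Riemannian metrics and harmonic functions\<close>

definition riemannian_metric ::
  "('m, 'e::euclidean_space) chart set \<Rightarrow> ('m \<Rightarrow> 'e \<Rightarrow> 'e \<Rightarrow> real) \<Rightarrow> bool" where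
  "riemannian_metric A g \<longleftrightarrow>
     (\<forall>x. bilinear (g x) \<and> (\<forall>v w. g x v w = g x w v) \<and> (\<forall>v. v \<noteq> 0 \<longrightarrow> g x v v > 0)) \<and>
     (\<forall>c\<in>A. \<forall>v w. smooth_on (chart_image c) (\<lambda>y. local_bilinear A c g y v w))"

(* In the next four definitions G is the metric on an open subset of 'e, in coordinates.
   The Levi-Civita connection is D_u X + christoffel G y u (X y); its Christoffel map is given by
   the Koszul formula for constant vector fields. The Laplacian is div grad, where the divergence
   of X is the trace of u |-> D_u X + christoffel G y u (X y). *)
definition christoffel ::
  "('e::euclidean_space \<Rightarrow> 'e \<Rightarrow> 'e \<Rightarrow> real) \<Rightarrow> 'e \<Rightarrow> 'e \<Rightarrow> 'e \<Rightarrow> 'e" where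
  "christoffel G y u v = (THE z. \<forall>w.
     2 * G y z w = frechet_derivative (\<lambda>y. G y v w) (at y) u
                 + frechet_derivative (\<lambda>y. G y u w) (at y) v
                 - frechet_derivative (\<lambda>y. G y u v) (at y) w)"

definition local_gradient ::
  "('e::euclidean_space \<Rightarrow> 'e \<Rightarrow> 'e \<Rightarrow> real) \<Rightarrow> ('e \<Rightarrow> real) \<Rightarrow> 'e \<Rightarrow> 'e" where
  "local_gradient G f y = (THE z. \<forall>w. G y z w = frechet_derivative f (at y) w)"

definition local_divergence ::
  "('e::euclidean_space \<Rightarrow> 'e \<Rightarrow> 'e \<Rightarrow> real) \<Rightarrow> ('e \<Rightarrow> 'e) \<Rightarrow> 'e \<Rightarrow> real" where
  "local_divergence G X y =
     (\<Sum>b\<in>Basis. (frechet_derivative X (at y) b + christoffel G y b (X y)) \<bullet> b)"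

definition local_laplacian ::
  "('e::euclidean_space \<Rightarrow> 'e \<Rightarrow> 'e \<Rightarrow> real) \<Rightarrow> ('e \<Rightarrow> real) \<Rightarrow> 'e \<Rightarrow> real" where
  "local_laplacian G f y = local_divergence G (local_gradient G f) y"

definition harmonic_fun ::
  "('m, 'e::euclidean_space) chart set \<Rightarrow> ('m \<Rightarrow> 'e \<Rightarrow> 'e \<Rightarrow> real) \<Rightarrow> ('m \<Rightarrow> real) \<Rightarrow> bool" where
  "harmonic_fun A g f \<longleftrightarrow> smooth_fun A f \<and>
     (\<forall>c\<in>A. \<forall>y\<in>chart_image c. local_laplacian (local_bilinear A c g) (f \<circ> chart_inv c) y = 0)"

definition riemannian_isometry ::
  "('m::topological_space, 'e::euclidean_space) chart set \<Rightarrow> ('m \<Rightarrow> 'e \<Rightarrow> 'e \<Rightarrow> real) \<Rightarrow>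
   ('m \<Rightarrow> 'm) \<Rightarrow> bool" where
  "riemannian_isometry A g f \<longleftrightarrow> bij f \<and> smooth_map A A f \<and> smooth_map A A (inv f) \<and>
     (\<forall>x v w. g (f x) (tangent_map A A f x v) (tangent_map A A f x w) = g x v w)"


section \<open>Kaehler and hyper-Kaehler structures\<close>

definition lie_bracket ::
  "('e::euclidean_space \<Rightarrow> 'e) \<Rightarrow> ('e \<Rightarrow> 'e) \<Rightarrow> 'e \<Rightarrow> 'e" where
  "lie_bracket X Y y = frechet_derivative Y (at y) (X y) - frechet_derivative X (at y) (Y y)"

definition nijenhuis ::
  "('e::euclidean_space \<Rightarrow> 'e \<Rightarrow> 'e) \<Rightarrow> ('e \<Rightarrow> 'e) \<Rightarrow> ('e \<Rightarrow> 'e) \<Rightarrow> 'e \<Rightarrow> 'e" where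
  "nijenhuis J X Y y =
     (let JX = (\<lambda>y. J y (X y)); JY = (\<lambda>y. J y (Y y))
      in lie_bracket JX JY y - J y (lie_bracket JX Y y) - J y (lie_bracket X JY y)
         - lie_bracket X Y y)"

(* Integrable almost complex structure. The Nijenhuis tensor is tensorial, so it is enough that
   it vanishes on constant coordinate vector fields. *)
definition complex_structure ::
  "('m, 'e::euclidean_space) chart set \<Rightarrow> ('m \<Rightarrow> 'e \<Rightarrow> 'e) \<Rightarrow> bool" where
  "complex_structure A J \<longleftrightarrow>
     (\<forall>x. linear (J x) \<and> (\<forall>v. J x (J x v) = - v)) \<and>
     (\<forall>c\<in>A. \<forall>v. smooth_on (chart_image c) (\<lambda>y. local_endo A c J y v)) \<and>
     (\<forall>c\<in>A. \<forall>y\<in>chart_image c. \<forall>v w.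
        nijenhuis (local_endo A c J) (\<lambda>_. v) (\<lambda>_. w) y = 0)"

definition closed_2form ::
  "('m, 'e::euclidean_space) chart set \<Rightarrow> ('m \<Rightarrow> 'e \<Rightarrow> 'e \<Rightarrow> real) \<Rightarrow> bool" where
  "closed_2form A \<omega> \<longleftrightarrow>
     (\<forall>x. bilinear (\<omega> x) \<and> (\<forall>v w. \<omega> x v w = - \<omega> x w v)) \<and>
     (\<forall>c\<in>A. \<forall>v w. smooth_on (chart_image c) (\<lambda>y. local_bilinear A c \<omega> y v w)) \<and>
     (\<forall>c\<in>A. \<forall>y\<in>chart_image c. \<forall>u v w.
        frechet_derivative (\<lambda>y. local_bilinear A c \<omega> y v w) (at y) u +
        frechet_derivative (\<lambda>y. local_bilinear A c \<omega> y w u) (at y) v +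
        frechet_derivative (\<lambda>y. local_bilinear A c \<omega> y u v) (at y) w = 0)"

definition kaehler_form ::
  "('m \<Rightarrow> 'e \<Rightarrow> 'e \<Rightarrow> real) \<Rightarrow> ('m \<Rightarrow> 'e \<Rightarrow> 'e) \<Rightarrow> 'm \<Rightarrow> 'e \<Rightarrow> 'e \<Rightarrow> real" where
  "kaehler_form g J x v w = g x (J x v) w"

definition kaehler_structure ::
  "('m, 'e::euclidean_space) chart set \<Rightarrow> ('m \<Rightarrow> 'e \<Rightarrow> 'e \<Rightarrow> real) \<Rightarrow>
   ('m \<Rightarrow> 'e \<Rightarrow> 'e) \<Rightarrow> bool" where
  "kaehler_structure A g J \<longleftrightarrow> riemannian_metric A g \<and> complex_structure A J \<and>
     (\<forall>x v w. g x (J x v) (J x w) = g x v w) \<and> closed_2form A (kaehler_form g J)"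

definition hyper_kaehler ::
  "('m, 'e::euclidean_space) chart set \<Rightarrow> ('m \<Rightarrow> 'e \<Rightarrow> 'e \<Rightarrow> real) \<Rightarrow>
   ('m \<Rightarrow> 'e \<Rightarrow> 'e) \<Rightarrow> ('m \<Rightarrow> 'e \<Rightarrow> 'e) \<Rightarrow> ('m \<Rightarrow> 'e \<Rightarrow> 'e) \<Rightarrow> bool" where
  "hyper_kaehler A g J1 J2 J3 \<longleftrightarrow>
     kaehler_structure A g J1 \<and> kaehler_structure A g J2 \<and> kaehler_structure A g J3 \<and>
     (\<forall>x v. J1 x (J2 x v) = J3 x v \<and> J3 x v = - J2 x (J1 x v))"

definition admissible ::
  "('m, 'e::euclidean_space) chart set \<Rightarrow> ('m \<Rightarrow> 'e \<Rightarrow> 'e \<Rightarrow> real) \<Rightarrow>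
   ('m \<Rightarrow> 'e \<Rightarrow> 'e) \<Rightarrow> ('m \<Rightarrow> 'e \<Rightarrow> 'e) \<Rightarrow> ('m \<Rightarrow> 'e \<Rightarrow> 'e) \<Rightarrow> ('m \<Rightarrow> 'e \<Rightarrow> 'e) \<Rightarrow> bool" where
  "admissible A g J1 J2 J3 J \<longleftrightarrow> kaehler_structure A g J \<and>
     (\<exists>q :: real ^ 3. norm q = 1 \<and>
        (\<forall>x v. J x v = (q $ 1) *\<^sub>R J1 x v + (q $ 2) *\<^sub>R J2 x v + (q $ 3) *\<^sub>R J3 x v))"

definition holomorphic_map ::
  "('m::topological_space, 'e::euclidean_space) chart set \<Rightarrow> ('m \<Rightarrow> 'e \<Rightarrow> 'e) \<Rightarrow>
   ('m \<Rightarrow> 'm) \<Rightarrow> bool" where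
  "holomorphic_map A J f \<longleftrightarrow> smooth_map A A f \<and>
     (\<forall>x v. tangent_map A A f x (J x v) = J (f x) (tangent_map A A f x v))"

definition triholomorphic_isometry ::
  "('m::topological_space, 'e::euclidean_space) chart set \<Rightarrow> ('m \<Rightarrow> 'e \<Rightarrow> 'e \<Rightarrow> real) \<Rightarrow>
   ('m \<Rightarrow> 'e \<Rightarrow> 'e) \<Rightarrow> ('m \<Rightarrow> 'e \<Rightarrow> 'e) \<Rightarrow> ('m \<Rightarrow> 'e \<Rightarrow> 'e) \<Rightarrow> ('m \<Rightarrow> 'm) \<Rightarrow> bool" where
  "triholomorphic_isometry A g J1 J2 J3 f \<longleftrightarrow> riemannian_isometry A g f \<and>
     holomorphic_map A J1 f \<and> holomorphic_map A J2 f \<and> holomorphic_map A J3 f"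


section \<open>Lie group actions and moment maps\<close>

(* Abelian groups are written additively; the Lie algebra is the tangent space at 0, that is,
   the model space 'k of the atlas. *)
definition abelian_lie_group ::
  "('t::{ab_group_add,second_countable_topology,t2_space}, 'k::euclidean_space) chart set \<Rightarrow> bool" where
  "abelian_lie_group A \<longleftrightarrow> smooth_atlas A \<and>
     smooth_map (prod_atlas A A) A (\<lambda>(s, t). s + t) \<and> smooth_map A A uminus"

definition smooth_action ::
  "('t::{ab_group_add,topological_space}, 'k::euclidean_space) chart set \<Rightarrow>
   ('m::topological_space, 'e::euclidean_space) chart set \<Rightarrow> ('t \<Rightarrow> 'm \<Rightarrow> 'm) \<Rightarrow> bool" where
  "smooth_action B A \<rho> \<longleftrightarrow>
     (\<forall>x. \<rho> 0 x = x) \<and> (\<forall>s t x. \<rho> (s + t) x = \<rho> s (\<rho> t x)) \<and>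
     smooth_map (prod_atlas B A) A (\<lambda>(t, x). \<rho> t x)"

definition nontrivial_action :: "('t \<Rightarrow> 'm \<Rightarrow> 'm) \<Rightarrow> bool" where
  "nontrivial_action \<rho> \<longleftrightarrow> (\<exists>x. range (\<lambda>t. \<rho> t x) \<noteq> {x})"

(* The differential at 0 of the orbit map of x, applied to v. *)
definition fundamental_field ::
  "('t::zero, 'k::euclidean_space) chart set \<Rightarrow> ('m, 'e::euclidean_space) chart set \<Rightarrow>
   ('t \<Rightarrow> 'm \<Rightarrow> 'm) \<Rightarrow> 'k \<Rightarrow> 'm \<Rightarrow> 'e" where
  "fundamental_field B A \<rho> v x = tangent_map B A (\<lambda>t. \<rho> t x) 0 v"

definition hamiltonian ::
  "('m, 'e::euclidean_space) chart set \<Rightarrow> ('m \<Rightarrow> 'e \<Rightarrow> 'e \<Rightarrow> real) \<Rightarrow> ('m \<Rightarrow> 'e) \<Rightarrow>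
   ('m \<Rightarrow> real) \<Rightarrow> bool" where
  "hamiltonian A \<omega> V f \<longleftrightarrow> smooth_fun A f \<and> (\<forall>x w. differential A f x w = \<omega> x (V x) w)"

(* The dual of the Lie algebra 'k is the space of bounded linear functionals on 'k, which are all
   the linear ones since 'k is finite-dimensional. *)
definition moment_map ::
  "('t::zero, 'k::euclidean_space) chart set \<Rightarrow> ('m, 'e::euclidean_space) chart set \<Rightarrow>
   ('m \<Rightarrow> 'e \<Rightarrow> 'e \<Rightarrow> real) \<Rightarrow> ('t \<Rightarrow> 'm \<Rightarrow> 'm) \<Rightarrow> ('m \<Rightarrow> 'k \<Rightarrow>\<^sub>L real) \<Rightarrow> bool" where
  "moment_map B A \<omega> \<rho> \<phi> \<longleftrightarrow>
     (\<forall>v. hamiltonian A \<omega> (fundamental_field B A \<rho> v) (\<lambda>x. blinfun_apply (\<phi> x) v))"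

definition harmonic_map ::
  "('m, 'e::euclidean_space) chart set \<Rightarrow> ('m \<Rightarrow> 'e \<Rightarrow> 'e \<Rightarrow> real) \<Rightarrow>
   ('m \<Rightarrow> 'k::euclidean_space \<Rightarrow>\<^sub>L real) \<Rightarrow> bool" where
  "harmonic_map A g \<phi> \<longleftrightarrow> (\<forall>v. harmonic_fun A g (\<lambda>x. blinfun_apply (\<phi> x) v))"

end

theory Submission
  imports Defs
begin

text \<open>
  Let \<open>V\<close> be a fundamental field and \<open>\<omega>\<^sub>i\<close> the Kaehler form of \<open>J\<^sub>i\<close>. The action preserves every
  \<open>\<omega>\<^sub>i\<close>, so by Cartan's formula all contractions \<open>\<omega>\<^sub>i(V, \<cdot>)\<close> are closed, hence exact; this gives the
  moment map. Its \<open>V\<close>-component has gradient \<open>J V = \<Sum>\<^sub>i q\<^sup>i J\<^sub>i V\<close>, so it suffices that each \<open>J\<^sub>i V\<close> is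
  divergence-free. With \<open>(i, j, k)\<close> a cyclic permutation of \<open>(1, 2, 3)\<close> we have \<open>J\<^sub>j J\<^sub>i V = - J\<^sub>k V\<close>, so
  contracting \<open>\<omega>\<^sub>j\<close> with \<open>J\<^sub>i V\<close> gives the closed form \<open>- \<omega>\<^sub>k(V, \<cdot>)\<close>. Thus \<open>J\<^sub>i V\<close> is a symplectic vector
  field for \<open>\<omega>\<^sub>j\<close>, and it preserves the Liouville volume of \<open>\<omega>\<^sub>j\<close>, which is the Riemannian volume.
\<close>

section \<open>Calculus of \<open>C\<^sup>k\<close> functions\<close>

text \<open>Neither flows nor integration nor determinants occur. Tangent vectors at x are read in a
  selected chart that jumps with x, so every identity is moved to one fixed chart, where all fields
  live on an open subset of a Euclidean space. Invariance of \<omega> is differentiated in the group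
  parameter at 0; exchanging the mixed second derivatives of the local action turns the result into
  L_V \<omega> = 0. The index shift from i to j is forced: contracting the i-th Kaehler form with
  J_i V gives -g(V, _), which the symmetry does not make closed. The comparison of volumes becomes a
  trace identity. The divergence of X at y is tr DX plus half the trace of the derivative of G along
  X, written as a G-endomorphism. The vanishing of L_X \<omega> for \<omega> = G(K _, _) relates
  these two traces up to a term with the derivative of K, and that term has trace zero because K^2 =
  -1.\<close>

abbreviation D :: "('a::real_normed_vector \<Rightarrow> 'b::real_normed_vector) \<Rightarrow> 'a \<Rightarrow> 'a \<Rightarrow> 'b" where
  "D f x \<equiv> frechet_derivative f (at x)"

lemma D_eqI: "(f has_derivative f') (at x) \<Longrightarrow> D f x = f'"
  by (metis frechet_derivative_at)

lemma has_D: "f differentiable (at x) \<Longrightarrow> (f has_derivative D f x) (at x)"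
  by (simp add: frechet_derivative_works)

lemma differentiable_transform_open:
  assumes "f differentiable (at x)" "open S" "x \<in> S" "\<And>x. x \<in> S \<Longrightarrow> f x = g x"
  shows "g differentiable (at x)"
  using assms by (meson differentiable_def has_derivative_transform_within_open)

lemma Ck_on_cong:
  assumes "open S" "\<And>x. x \<in> S \<Longrightarrow> f x = g x" "Ck_on k S f"
  shows "Ck_on k S g"
  using assms(2,3)
proof (induction k arbitrary: f g)
  case 0
  then show ?case by (simp cong: continuous_on_cong)
next
  case (Suc k)
  have "g differentiable (at x)" if "x \<in> S" for x
    using Suc.prems assms(1) that differentiable_transform_open[of f x S g] by auto
  moreover have "Ck_on k S (\<lambda>x. D g x v)" for v
  proof (rule Suc.IH)
    show "Ck_on k S (\<lambda>x. D f x v)" using Suc.prems by simp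
    show "D f x v = D g x v" if "x \<in> S" for x
      using frechet_derivative_transform_within_open[of f x S g] Suc.prems assms(1) that by simp
  qed
  ultimately show ?case by simp
qed

lemma Ck_on_Suc_imp: "Ck_on (Suc k) S f \<Longrightarrow> Ck_on k S f"
proof (induction k arbitrary: f)
  case 0
  then show ?case
    by (auto intro!: continuous_at_imp_continuous_on differentiable_imp_continuous_within)
qed auto

lemma Ck_on_const: "Ck_on k S (\<lambda>x. c)"
  by (induction k arbitrary: c) auto

lemma Ck_on_add:
  assumes "open S" "Ck_on k S f" "Ck_on k S g"
  shows "Ck_on k S (\<lambda>x. f x + g x)"
  using assms(2,3)
proof (induction k arbitrary: f g)
  case 0
  then show ?case by (auto intro: continuous_on_add)
next
  case (Suc k)
  have "Ck_on k S (\<lambda>x. D (\<lambda>x. f x + g x) x v)" for v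
  proof (rule Ck_on_cong[OF assms(1)])
    show "Ck_on k S (\<lambda>x. D f x v + D g x v)" using Suc by simp
    show "D f x v + D g x v = D (\<lambda>x. f x + g x) x v" if "x \<in> S" for x
      using Suc.prems that by (subst D_eqI[OF has_derivative_add[OF has_D has_D]]) auto
  qed
  then show ?case using Suc.prems by auto
qed

lemma Ck_on_linear:
  assumes "open S" "bounded_linear L" "Ck_on k S f"
  shows "Ck_on k S (\<lambda>x. L (f x))"
  using assms(3)
proof (induction k arbitrary: f)
  case 0
  then show ?case using assms(2) by (auto intro: bounded_linear.continuous_on)
next
  case (Suc k)
  have der: "((\<lambda>x. L (f x)) has_derivative (\<lambda>v. L (D f x v))) (at x)" if "x \<in> S" for x
    using bounded_linear.has_derivative[OF assms(2) has_D] Suc.prems that by auto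
  have "Ck_on k S (\<lambda>x. D (\<lambda>x. L (f x)) x v)" for v
  proof (rule Ck_on_cong[OF assms(1)])
    show "Ck_on k S (\<lambda>x. L (D f x v))" using Suc by simp
    show "L (D f x v) = D (\<lambda>x. L (f x)) x v" if "x \<in> S" for x
      using D_eqI[OF der[OF that]] by simp
  qed
  then show ?case using differentiableI[OF der] by simp
qed

lemma Ck_on_mult:
  fixes f g :: "'a::real_normed_vector \<Rightarrow> real"
  assumes "open S" "Ck_on k S f" "Ck_on k S g"
  shows "Ck_on k S (\<lambda>x. f x * g x)"
  using assms(2,3)
proof (induction k arbitrary: f g)
  case 0
  then show ?case by (auto intro: continuous_on_mult)
next
  case (Suc k)
  have "Ck_on k S (\<lambda>x. D (\<lambda>x. f x * g x) x v)" for v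
  proof (rule Ck_on_cong[OF assms(1)])
    \<comment> \<open>The Leibniz rule leaves one factor undifferentiated, so the induction
      hypothesis is applied to \<open>f\<close> and \<open>g\<close> themselves, lowered by one
      order of smoothness.\<close>
    show "Ck_on k S (\<lambda>x. f x * D g x v + D f x v * g x)"
      using Suc Ck_on_Suc_imp[of k S f] Ck_on_Suc_imp[of k S g]
      by (intro Ck_on_add Suc.IH assms(1)) auto
    show "f x * D g x v + D f x v * g x = D (\<lambda>x. f x * g x) x v" if "x \<in> S" for x
      using Suc.prems that by (subst D_eqI[OF has_derivative_mult[OF has_D has_D]]) auto
  qed
  then show ?case using Suc.prems by auto
qed

section \<open>Partial maps of a function on a product\<close>

lemma has_derivative_slice:
  assumes "F differentiable (at (p, y))"
  shows "((\<lambda>y. F (p, y)) has_derivative (\<lambda>v. D F (p, y) (0, v))) (at y)"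
proof -
  have "((\<lambda>y. (p, y)) has_derivative (\<lambda>v. (0, v))) (at y)"
    by (auto intro!: derivative_eq_intros)
  from diff_chain_at[OF this has_D[OF assms]] show ?thesis by (simp add: o_def)
qed

lemma has_derivative_slice_left:
  assumes "F differentiable (at (p, y))"
  shows "((\<lambda>p. F (p, y)) has_derivative (\<lambda>v. D F (p, y) (v, 0))) (at p)"
proof -
  have "((\<lambda>p. (p, y)) has_derivative (\<lambda>v. (v, 0))) (at p)"
    by (auto intro!: derivative_eq_intros)
  from diff_chain_at[OF this has_D[OF assms]] show ?thesis by (simp add: o_def)
qed

text \<open>The derivative of a slice is the slice of the map \<open>D F _ (0, v)\<close>, so the
  induction runs over all \<open>F\<close> with \<open>p\<close> fixed. Applied at the neutral
  element of the group, this makes the fundamental fields smooth.\<close>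

lemma Ck_on_slice:
  assumes "open T" "\<And>y. y \<in> T \<Longrightarrow> (p, y) \<in> W" "Ck_on k W F"
  shows "Ck_on k T (\<lambda>y. F (p, y))"
  using assms(3)
proof (induction k arbitrary: F)
  case 0
  then show ?case using assms(2)
    by (auto intro!: continuous_on_compose2[of W F T "\<lambda>y. (p, y)"] continuous_intros)
next
  case (Suc k)
  have der: "((\<lambda>y. F (p, y)) has_derivative (\<lambda>v. D F (p, y) (0, v))) (at y)" if "y \<in> T" for y
    using Suc.prems assms(2)[OF that] by (intro has_derivative_slice) auto
  have "Ck_on k T (\<lambda>y. D (\<lambda>y. F (p, y)) y v)" for v
  proof (rule Ck_on_cong[OF assms(1)])
    show "Ck_on k T (\<lambda>y. D F (p, y) (0, v))"
      using Suc.prems by (intro Suc.IH) auto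
    show "D F (p, y) (0, v) = D (\<lambda>y. F (p, y)) y v" if "y \<in> T" for y
      using D_eqI[OF der[OF that]] by simp
  qed
  then show ?case using differentiableI[OF der] by simp
qed

lemma smooth_on_cong:
  "open S \<Longrightarrow> (\<And>x. x \<in> S \<Longrightarrow> f x = g x) \<Longrightarrow> smooth_on S f \<Longrightarrow> smooth_on S g"
  unfolding smooth_on_def by (blast intro: Ck_on_cong)

lemma smooth_on_D: "smooth_on S f \<Longrightarrow> smooth_on S (\<lambda>x. D f x v)"
  unfolding smooth_on_def by (metis Ck_on.simps(2))

lemma smooth_on_slice:
  "open T \<Longrightarrow> (\<And>y. y \<in> T \<Longrightarrow> (p, y) \<in> W) \<Longrightarrow> smooth_on W F \<Longrightarrow> smooth_on T (\<lambda>y. F (p, y))"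
  unfolding smooth_on_def by (blast intro: Ck_on_slice)

lemma smooth_on_linear:
  "open S \<Longrightarrow> bounded_linear L \<Longrightarrow> smooth_on S f \<Longrightarrow> smooth_on S (\<lambda>x. L (f x))"
  unfolding smooth_on_def by (blast intro: Ck_on_linear)

lemma smooth_on_mult:
  fixes f g :: "'a::real_normed_vector \<Rightarrow> real"
  shows "open S \<Longrightarrow> smooth_on S f \<Longrightarrow> smooth_on S g \<Longrightarrow> smooth_on S (\<lambda>x. f x * g x)"
  unfolding smooth_on_def by (blast intro: Ck_on_mult)

lemma smooth_on_sum:
  assumes "open S" "\<And>i. i \<in> I \<Longrightarrow> smooth_on S (f i)"
  shows "smooth_on S (\<lambda>x. \<Sum>i\<in>I. f i x)"
  using assms(2)
proof (induction I rule: infinite_finite_induct)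
  case (insert i I)
  then show ?case using assms(1) by (simp add: smooth_on_def Ck_on_add)
qed (auto simp: smooth_on_def Ck_on_const)

lemma smooth_on_differentiable: "smooth_on S f \<Longrightarrow> x \<in> S \<Longrightarrow> f differentiable (at x)"
  unfolding smooth_on_def by (metis Ck_on.simps(2))

section \<open>Symmetry of second derivatives\<close>

lemma has_real_derivative_line:
  fixes f :: "'a::real_normed_vector \<Rightarrow> real"
  assumes "f differentiable (at (x + s *\<^sub>R a))"
  shows "((\<lambda>s. f (x + s *\<^sub>R a)) has_real_derivative D f (x + s *\<^sub>R a) a) (at s)"
proof -
  interpret linear "D f (x + s *\<^sub>R a)"
    using assms by (rule linear_frechet_derivative)
  have "((\<lambda>s. x + s *\<^sub>R a) has_derivative (\<lambda>h. h *\<^sub>R a)) (at s)"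
    by (auto intro!: derivative_eq_intros)
  from diff_chain_at[OF this has_D[OF assms]] show ?thesis
    by (simp add: o_def has_field_derivative_def scale mult_commute_abs)
qed

(* Two applications of the mean value theorem to the second difference of f. *)
lemma second_difference_mvt:
  fixes f :: "'a::real_normed_vector \<Rightarrow> real"
  assumes "Ck_on 2 S f" "h > 0"
    and "\<And>s t. 0 \<le> s \<Longrightarrow> s \<le> h \<Longrightarrow> 0 \<le> t \<Longrightarrow> t \<le> h \<Longrightarrow> x + s *\<^sub>R a + t *\<^sub>R b \<in> S"
  obtains s t where "0 \<le> s" "s \<le> h" "0 \<le> t" "t \<le> h"
    "f (x + h *\<^sub>R a + h *\<^sub>R b) - f (x + h *\<^sub>R a) - f (x + h *\<^sub>R b) + f x
       = h * h * D (\<lambda>y. D f y a) (x + s *\<^sub>R a + t *\<^sub>R b) b"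
proof -
  have d1: "f differentiable (at y)" and d2: "(\<lambda>y. D f y a) differentiable (at y)" if "y \<in> S" for y
    using assms(1) that by (auto simp: numeral_2_eq_2)
  define \<phi> where "\<phi> s = f (x + h *\<^sub>R b + s *\<^sub>R a) - f (x + s *\<^sub>R a)" for s
  have "(\<phi> has_real_derivative (D f (x + h *\<^sub>R b + s *\<^sub>R a) a - D f (x + s *\<^sub>R a) a)) (at s)"
    if "0 \<le> s" "s \<le> h" for s
    unfolding \<phi>_def
    using d1[OF assms(3)[OF that, of h]] d1[OF assms(3)[OF that, of 0]] assms(2)
    by (intro derivative_intros has_real_derivative_line) (auto simp: algebra_simps)
  from MVT2[OF assms(2) this] obtain s where s: "0 < s" "s < h"
    "\<phi> h - \<phi> 0 = h * (D f (x + h *\<^sub>R b + s *\<^sub>R a) a - D f (x + s *\<^sub>R a) a)" by auto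
  have "((\<lambda>t. D f (x + s *\<^sub>R a + t *\<^sub>R b) a) has_real_derivative
      D (\<lambda>y. D f y a) (x + s *\<^sub>R a + t *\<^sub>R b) b) (at t)" if "0 \<le> t" "t \<le> h" for t
    using has_real_derivative_line[OF d2[OF assms(3)], of s t] s that by auto
  from MVT2[OF assms(2) this] obtain t where t: "0 < t" "t < h"
    "D f (x + s *\<^sub>R a + h *\<^sub>R b) a - D f (x + s *\<^sub>R a) a
      = h * D (\<lambda>y. D f y a) (x + s *\<^sub>R a + t *\<^sub>R b) b" by auto
  show ?thesis
  proof
    show "f (x + h *\<^sub>R a + h *\<^sub>R b) - f (x + h *\<^sub>R a) - f (x + h *\<^sub>R b) + f x
       = h * h * D (\<lambda>y. D f y a) (x + s *\<^sub>R a + t *\<^sub>R b) b"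
      using s(3) t(3) by (simp add: \<phi>_def add_ac)
  qed (use s t in auto)
qed

text \<open>The second difference of \<open>f\<close> over a small parallelogram is symmetric in
  \<open>a\<close> and \<open>b\<close>. In either order it is h^2 times a mixed derivative at a
  nearby point, and both mixed derivatives are continuous.\<close>

lemma D_D_commute_real:
  fixes f :: "'a::real_normed_vector \<Rightarrow> real"
  assumes "open S" "x \<in> S" "Ck_on 2 S f"
  shows "D (\<lambda>y. D f y a) x b = D (\<lambda>y. D f y b) x a"
proof (rule ccontr)
  define u where "u y = D (\<lambda>y. D f y a) y b" for y
  define w where "w y = D (\<lambda>y. D f y b) y a" for y
  assume "\<not> ?thesis"
  then have ne: "u x \<noteq> w x" by (simp add: u_def w_def)
  \<comment> \<open>Half of the gap: a number within \<open>e\<close> of \<open>u x\<close> and a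
    number within \<open>e\<close> of \<open>w x\<close> cannot be equal.\<close>
  define e where "e = \<bar>u x - w x\<bar> / 2"
  have e: "e > 0" using ne by (simp add: e_def)
  have "continuous_on S u" "continuous_on S w"
    using assms(3) by (auto simp: u_def w_def numeral_2_eq_2)
  then have "\<exists>d>0. \<forall>y\<in>S. dist y x < d \<longrightarrow> dist (u y) (u x) < e"
    "\<exists>d>0. \<forall>y\<in>S. dist y x < d \<longrightarrow> dist (w y) (w x) < e"
    using e assms(2) unfolding continuous_on_iff by blast+
  moreover obtain r where "r > 0" "ball x r \<subseteq> S" using assms(1,2) open_contains_ball by blast
  ultimately obtain d1 d2 where d: "d1 > 0" "d2 > 0" 
    "\<And>y. y \<in> S \<Longrightarrow> dist y x < d1 \<Longrightarrow> dist (u y) (u x) < e"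
    "\<And>y. y \<in> S \<Longrightarrow> dist y x < d2 \<Longrightarrow> dist (w y) (w x) < e" by blast
  define d where "d = min r (min d1 d2)"
  \<comment> \<open>The whole parallelogram with sides \<open>h\<close> times \<open>a\<close> and
    \<open>b\<close> then stays within d / 2 of \<open>x\<close>. The summand 1 keeps the
    denominator positive when both vectors vanish.\<close>
  define h where "h = d / (norm a + norm b + 1) / 2"
  have dpos: "d > 0" using d(1,2) \<open>r > 0\<close> by (simp add: d_def)
  have h: "h > 0" using dpos unfolding h_def
    by (intro divide_pos_pos) (auto intro: add_nonneg_pos)
  have near: "dist (x + s *\<^sub>R a + t *\<^sub>R b) x < d" if "0 \<le> s" "s \<le> h" "0 \<le> t" "t \<le> h" for s t
  proof -
    have "dist (x + s *\<^sub>R a + t *\<^sub>R b) x \<le> s * norm a + t * norm b"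
      using norm_triangle_ineq[of "s *\<^sub>R a" "t *\<^sub>R b"] that
      by (simp add: dist_norm add.assoc)
    also have "\<dots> \<le> h * norm a + h * norm b" using that by (intro add_mono mult_right_mono) auto
    also have "\<dots> \<le> h * (norm a + norm b + 1)" using h by (simp add: algebra_simps)
    also have "\<dots> = d / 2"
      by (smt (verit) h_def divide_eq_0_iff norm_ge_zero nonzero_eq_divide_eq times_divide_eq_left)
    finally show ?thesis using dpos by simp
  qed
  have inS: "x + s *\<^sub>R a + t *\<^sub>R b \<in> S" if "0 \<le> s" "s \<le> h" "0 \<le> t" "t \<le> h" for s t
    using near[OF that] \<open>ball x r \<subseteq> S\<close> by (auto simp: d_def dist_commute)
  obtain s t where st: "0 \<le> s" "s \<le> h" "0 \<le> t" "t \<le> h"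
    "f (x + h *\<^sub>R a + h *\<^sub>R b) - f (x + h *\<^sub>R a) - f (x + h *\<^sub>R b) + f x
       = h * h * u (x + s *\<^sub>R a + t *\<^sub>R b)"
    unfolding u_def by (rule second_difference_mvt[OF assms(3) h inS])
  have inS': "x + t *\<^sub>R b + s *\<^sub>R a \<in> S" if "0 \<le> t" "t \<le> h" "0 \<le> s" "s \<le> h" for s t
    using inS[of s t] that by (simp add: add_ac)
  obtain t' s' where st': "0 \<le> t'" "t' \<le> h" "0 \<le> s'" "s' \<le> h"
    "f (x + h *\<^sub>R b + h *\<^sub>R a) - f (x + h *\<^sub>R b) - f (x + h *\<^sub>R a) + f x
       = h * h * w (x + t' *\<^sub>R b + s' *\<^sub>R a)"
    unfolding w_def by (rule second_difference_mvt[OF assms(3) h inS'])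
  have swap: "x + h *\<^sub>R b + h *\<^sub>R a = x + h *\<^sub>R a + h *\<^sub>R b" "x + t' *\<^sub>R b + s' *\<^sub>R a = x + s' *\<^sub>R a + t' *\<^sub>R b"
    by (simp_all add: add_ac)
  have "h * h * u (x + s *\<^sub>R a + t *\<^sub>R b) = h * h * w (x + s' *\<^sub>R a + t' *\<^sub>R b)"
    using st(5) st'(5) unfolding swap by linarith
  then have eq: "u (x + s *\<^sub>R a + t *\<^sub>R b) = w (x + s' *\<^sub>R a + t' *\<^sub>R b)"
    using h by simp
  have "dist (u (x + s *\<^sub>R a + t *\<^sub>R b)) (u x) < e"
    using d(3) near[OF st(1-4)] inS[OF st(1-4)] by (simp add: d_def)
  moreover have "dist (w (x + s' *\<^sub>R a + t' *\<^sub>R b)) (w x) < e"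
    using d(4) near[OF st'(3,4,1,2)] inS[OF st'(3,4,1,2)] by (simp add: d_def)
  ultimately show False using eq by (auto simp: e_def dist_real_def abs_if field_simps split: if_splits)
qed

lemma D_D_commute:
  fixes f :: "'a::real_normed_vector \<Rightarrow> 'b::euclidean_space"
  assumes "open S" "x \<in> S" "Ck_on 2 S f"
  shows "D (\<lambda>y. D f y a) x b = D (\<lambda>y. D f y b) x a"
proof (rule euclidean_eqI)
  fix i :: 'b assume "i \<in> Basis"
  have L: "bounded_linear (\<lambda>z. z \<bullet> i)" by (rule bounded_linear_inner_left)
  have dif: "f differentiable (at y)" and dif2: "(\<lambda>y. D f y c) differentiable (at y)"
    if "y \<in> S" for y c
    using assms(3) that by (auto simp: numeral_2_eq_2)
  have 1: "D (\<lambda>y. f y \<bullet> i) y c = D f y c \<bullet> i" if "y \<in> S" for y c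
    using D_eqI[OF bounded_linear.has_derivative[OF L has_D[OF dif[OF that]]]] by simp
  have 2: "D (\<lambda>y. D (\<lambda>y. f y \<bullet> i) y c) x d = D (\<lambda>y. D f y c) x d \<bullet> i" for c d
  proof -
    have h: "((\<lambda>y. D f y c \<bullet> i) has_derivative (\<lambda>d. D (\<lambda>y. D f y c) x d \<bullet> i)) (at x)"
      by (rule bounded_linear.has_derivative[OF L has_D[OF dif2[OF assms(2)]]])
    have "((\<lambda>y. D (\<lambda>y. f y \<bullet> i) y c) has_derivative (\<lambda>d. D (\<lambda>y. D f y c) x d \<bullet> i)) (at x)"
      by (rule has_derivative_transform_within_open[OF h assms(1,2)]) (simp add: 1)
    from D_eqI[OF this] show ?thesis by simp
  qed
  have "Ck_on 2 S (\<lambda>y. f y \<bullet> i)" by (rule Ck_on_linear[OF assms(1) L assms(3)])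
  from D_D_commute_real[OF assms(1,2) this, of a b]
  show "D (\<lambda>y. D f y a) x b \<bullet> i = D (\<lambda>y. D f y b) x a \<bullet> i" by (simp add: 2)
qed

section \<open>Traces and inner products\<close>

definition tr :: "('e::euclidean_space \<Rightarrow> 'e) \<Rightarrow> real" where
  "tr T = (\<Sum>b\<in>Basis. T b \<bullet> b)"

lemma tr_add: "tr (\<lambda>u. S u + T u) = tr S + tr T"
  by (simp add: tr_def inner_add_left sum.distrib)

lemma tr_uminus: "tr (\<lambda>u. - T u) = - tr T"
  by (simp add: tr_def sum_negf)

lemma tr_scaleR: "tr (\<lambda>u. c *\<^sub>R T u) = c * tr T"
  by (simp add: tr_def sum_distrib_left)

lemma tr_comp_commute:
  fixes S T :: "'e::euclidean_space \<Rightarrow> 'e"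
  assumes "linear S" "linear T"
  shows "tr (\<lambda>u. S (T u)) = tr (\<lambda>u. T (S u))"
proof -
  have *: "tr (\<lambda>u. P (Q u)) = (\<Sum>b\<in>Basis. \<Sum>c\<in>Basis. (Q b \<bullet> c) * (P c \<bullet> b))"
    if "linear P" for P Q :: "'e \<Rightarrow> 'e"
  proof -
    have "P (Q b) \<bullet> b = (\<Sum>c\<in>Basis. (Q b \<bullet> c) * (P c \<bullet> b))" for b
    proof -
      have "P (\<Sum>c\<in>Basis. (Q b \<bullet> c) *\<^sub>R c) \<bullet> b = (\<Sum>c\<in>Basis. (Q b \<bullet> c) * (P c \<bullet> b))"
        by (simp add: linear_sum[OF that] linear_cmul[OF that] inner_sum_left)
      then show ?thesis by (simp add: euclidean_representation)
    qed
    then show ?thesis by (simp add: tr_def)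
  qed
  show ?thesis
    unfolding *[OF assms(1)] *[OF assms(2)]
    by (subst sum.swap) (simp add: mult.commute)
qed

lemma tr_adjoint: "linear T \<Longrightarrow> tr (adjoint T) = tr T"
  by (simp add: tr_def adjoint_clauses inner_commute)

text \<open>Writes a varying form as a finite sum of scalar products, to which the ordinary product
  rule applies.\<close>

lemma bilinear_expand:
  fixes B :: "'e::euclidean_space \<Rightarrow> 'e \<Rightarrow> real"
  assumes "bilinear B"
  shows "B v w = (\<Sum>i\<in>Basis. \<Sum>j\<in>Basis. (v \<bullet> i) * (w \<bullet> j) * B i j)"
proof -
  have l: "linear (\<lambda>v. B v w)" "linear (B v)" for v w
    using assms by (auto simp: bilinear_def)
  have *: "B i w = (\<Sum>j\<in>Basis. (w \<bullet> j) * B i j)" for i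
  proof -
    have "B i w = B i (\<Sum>j\<in>Basis. (w \<bullet> j) *\<^sub>R j)" by (simp add: euclidean_representation)
    also have "\<dots> = (\<Sum>j\<in>Basis. (w \<bullet> j) * B i j)"
      by (simp add: linear_sum[OF l(2)] linear_cmul[OF l(2)])
    finally show ?thesis .
  qed
  have "B v w = B (\<Sum>i\<in>Basis. (v \<bullet> i) *\<^sub>R i) w"
    by (simp add: euclidean_representation)
  also have "\<dots> = (\<Sum>i\<in>Basis. (v \<bullet> i) * B i w)"
    by (simp add: linear_sum[OF l(1)] linear_cmul[OF l(1)])
  finally show ?thesis by (simp only: * sum_distrib_left mult.assoc)
qed

text \<open>A single fibre of the metric. \<open>tr\<close> and \<open>adjoint\<close> refer to the
  standard inner product of the model space, while the geometry provides adjoints with respect to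
  \<open>G\<close>; the lemmas here translate between the two.\<close>

locale inner_form =
  fixes G :: "'e::euclidean_space \<Rightarrow> 'e \<Rightarrow> real"
  assumes bilin: "bilinear G" and sym: "G v w = G w v" and pos: "v \<noteq> 0 \<Longrightarrow> G v v > 0"
begin

lemma eqI: "(\<And>w. G z w = G z' w) \<Longrightarrow> z = z'"
  using pos[of "z - z'"] bilinear_lsub[OF bilin, of z z' "z - z'"] by fastforce

text \<open>\<open>H\<close> is the Gram operator of \<open>G\<close>. Positivity makes it
  injective, hence invertible in finite dimension, with inverse \<open>R\<close>.\<close>

lemma matrix_exists:
  obtains H R where "linear H" "linear R" "\<And>z w. H z \<bullet> w = G z w" "\<And>z. H (R z) = z" "\<And>z. R (H z) = z"
proof -
  define H where "H z = (\<Sum>b\<in>Basis. G z b *\<^sub>R b)" for z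
  have lin: "linear H"
    unfolding H_def
    by (rule linearI) (simp_all add: bilinear_ladd[OF bilin] bilinear_lmul[OF bilin]
        scaleR_left_distrib sum.distrib scaleR_sum_right)
  have eq: "H z \<bullet> w = G z w" for z w
  proof -
    have "linear (G z)" using bilin by (simp add: bilinear_def)
    then have "G z (\<Sum>b\<in>Basis. (w \<bullet> b) *\<^sub>R b) = (\<Sum>b\<in>Basis. (w \<bullet> b) * G z b)"
      by (simp add: linear_sum linear_cmul)
    then have "G z w = (\<Sum>b\<in>Basis. (w \<bullet> b) * G z b)"
      by (simp add: euclidean_representation)
    then show ?thesis
      by (simp add: H_def inner_sum_left inner_sum_right inner_commute mult.commute)
  qed
  have "inj H"
    using eqI eq by (metis injI)
  then obtain R where "linear R" "\<And>z. H (R z) = z" "\<And>z. R (H z) = z"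
    using linear_injective_isomorphism[OF lin] by metis
  with that lin eq show ?thesis by blast
qed

lemma representable:
  fixes \<phi> :: "'e \<Rightarrow> real"
  assumes "linear \<phi>"
  shows "\<exists>!z. \<forall>w. G z w = \<phi> w"
proof -
  obtain H R where HR: "\<And>z w. H z \<bullet> w = G z w" "\<And>z. H (R z) = z"
    by (rule matrix_exists) blast
  \<comment> \<open>The adjoint of a functional sends 1 to its Riesz vector for the standard inner
    product; \<open>R\<close> converts this into the Riesz vector for \<open>G\<close>.\<close>
  have "\<phi> w = adjoint \<phi> 1 \<bullet> w" for w
    using adjoint_works[OF assms, of w 1] by (simp add: inner_commute)
  then have "\<forall>w. G (R (adjoint \<phi> 1)) w = \<phi> w"
    by (simp flip: HR(1) add: HR(2))
  then show ?thesis using eqI by metis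
qed

lemma linear_representing:
  assumes "\<And>u w. G (N u) w = B u w" "\<And>w. linear (\<lambda>u. B u w)"
  shows "linear N"
proof (rule linearI)
  show "N (u + v) = N u + N v" for u v
    by (rule eqI) (simp add: bilinear_ladd[OF bilin] assms linear_add[OF assms(2)])
  show "N (c *\<^sub>R u) = c *\<^sub>R N u" for c u
    by (rule eqI) (simp add: bilinear_lmul[OF bilin] assms linear_cmul[OF assms(2)])
qed

lemma bilinear_representable:
  assumes "bilinear B"
  obtains N where "linear N" "\<And>u w. G (N u) w = B u w"
proof -
  have "\<exists>z. \<forall>w. G z w = B u w" for u
    using representable[of "B u"] assms by (auto simp: bilinear_def)
  then obtain N where N: "\<And>u w. G (N u) w = B u w" by metis
  moreover have "linear N"
    by (rule linear_representing[OF N]) (use assms in \<open>auto simp: bilinear_def\<close>)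
  ultimately show ?thesis using that by blast
qed

text \<open>\<open>M\<close> is the conjugate by the Gram operator of the transpose of
  \<open>M'\<close>, and neither transposition nor conjugation changes a trace.\<close>

lemma tr_eq_of_adjoint:
  assumes "linear M'" "\<And>u v. G (M u) v = G u (M' v)"
  shows "tr M = tr M'"
proof -
  obtain H R where HR: "linear H" "linear R" "\<And>z w. H z \<bullet> w = G z w"
    "\<And>z. H (R z) = z" "\<And>z. R (H z) = z"
    by (rule matrix_exists) blast
  have "H (M u) = adjoint M' (H u)" for u
    by (rule vector_eq_rdot[THEN iffD1])
      (metis HR(3) adjoint_clauses(2) assms)
  then have "tr M = tr (\<lambda>u. R (adjoint M' (H u)))"
    by (metis HR(5))
  also have "\<dots> = tr (\<lambda>u. adjoint M' (H (R u)))"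
    using tr_comp_commute[OF HR(2), of "\<lambda>u. adjoint M' (H u)"]
      linear_compose[OF HR(1) adjoint_linear[OF assms(1)]] by (simp add: o_def)
  also have "\<dots> = tr M'" by (simp add: HR(4) tr_adjoint[OF assms(1)] eta_contract_eq)
  finally show ?thesis .
qed

end

section \<open>Bilinear forms on an open subset of Euclidean space\<close>

text \<open>No symmetry is imposed, so that metrics, Kaehler forms and the pairing of an
  endomorphism field with the standard inner product are all instances.\<close>

locale bilinear_field =
  fixes S :: "'e::euclidean_space set" and \<Omega> :: "'e \<Rightarrow> 'e \<Rightarrow> 'e \<Rightarrow> real"
  assumes open_S: "open S"
    and bilin: "y \<in> S \<Longrightarrow> bilinear (\<Omega> y)"
    and diff: "y \<in> S \<Longrightarrow> (\<lambda>z. \<Omega> z v w) differentiable (at y)"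
begin

text \<open>The parameter ranges over an arbitrary normed space: with \<open>H\<close> the identity
  this is the product rule for vector fields, with \<open>H\<close> an orbit map it differentiates a
  form along the group.\<close>

lemma has_derivative_along:
  assumes "H p \<in> S" "H differentiable (at p)" "X differentiable (at p)" "Y differentiable (at p)"
  shows "((\<lambda>q. \<Omega> (H q) (X q) (Y q)) has_derivative
    (\<lambda>h. D (\<lambda>z. \<Omega> z (X p) (Y p)) (H p) (D H p h)
       + \<Omega> (H p) (D X p h) (Y p) + \<Omega> (H p) (X p) (D Y p h))) (at p)"
proof -
  have ev: "eventually (\<lambda>q. H q \<in> S) (at p)"
    using topological_tendstoD[OF _ open_S assms(1)]
      differentiable_imp_continuous_within[OF assms(2)] by (simp add: continuous_within)
  have dc: "((\<lambda>q. \<Omega> (H q) i j) has_derivative (\<lambda>h. D (\<lambda>z. \<Omega> z i j) (H p) (D H p h))) (at p)" for i j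
    using diff_chain_at[OF has_D[OF assms(2)] has_D[OF diff[OF assms(1), of i j]]] by (simp add: o_def)
  have *: "((\<lambda>q. \<Sum>i\<in>Basis. \<Sum>j\<in>Basis. (X q \<bullet> i) * (Y q \<bullet> j) * \<Omega> (H q) i j) has_derivative
    (\<lambda>h. \<Sum>i\<in>Basis. \<Sum>j\<in>Basis. (X p \<bullet> i) * (Y p \<bullet> j) * D (\<lambda>z. \<Omega> z i j) (H p) (D H p h)
      + ((X p \<bullet> i) * (D Y p h \<bullet> j) + (D X p h \<bullet> i) * (Y p \<bullet> j)) * \<Omega> (H p) i j)) (at p)"
    by (intro has_derivative_sum has_derivative_mult dc
        bounded_linear.has_derivative[OF bounded_linear_inner_left has_D] assms)
  \<comment> \<open>Needed to collect the terms that differentiate the coefficients: with frozen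
    vectors they sum to a derivative of the form itself.\<close>
  have const: "D (\<lambda>z. \<Omega> z v w) (H p) u
      = (\<Sum>i\<in>Basis. \<Sum>j\<in>Basis. (v \<bullet> i) * (w \<bullet> j) * D (\<lambda>z. \<Omega> z i j) (H p) u)" for v w u
  proof -
    have "((\<lambda>z. \<Sum>i\<in>Basis. \<Sum>j\<in>Basis. (v \<bullet> i) * (w \<bullet> j) * \<Omega> z i j) has_derivative
      (\<lambda>u. \<Sum>i\<in>Basis. \<Sum>j\<in>Basis. (v \<bullet> i) * (w \<bullet> j) * D (\<lambda>z. \<Omega> z i j) (H p) u)) (at (H p))"
      by (intro has_derivative_sum has_derivative_mult_right has_D diff assms)
    then have "((\<lambda>z. \<Omega> z v w) has_derivative
      (\<lambda>u. \<Sum>i\<in>Basis. \<Sum>j\<in>Basis. (v \<bullet> i) * (w \<bullet> j) * D (\<lambda>z. \<Omega> z i j) (H p) u)) (at (H p))"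
      by (rule has_derivative_transform_within_open[OF _ open_S assms(1)])
        (rule bilinear_expand[OF bilin, symmetric])
    from D_eqI[OF this] show ?thesis by simp
  qed
  have eq: "(\<Sum>i\<in>Basis. \<Sum>j\<in>Basis. (X p \<bullet> i) * (Y p \<bullet> j) * D (\<lambda>z. \<Omega> z i j) (H p) (D H p h)
      + ((X p \<bullet> i) * (D Y p h \<bullet> j) + (D X p h \<bullet> i) * (Y p \<bullet> j)) * \<Omega> (H p) i j)
    = D (\<lambda>z. \<Omega> z (X p) (Y p)) (H p) (D H p h)
       + \<Omega> (H p) (D X p h) (Y p) + \<Omega> (H p) (X p) (D Y p h)" for h
    unfolding const[of "X p" "Y p"] bilinear_expand[OF bilin[OF assms(1)], of "D X p h" "Y p"]
      bilinear_expand[OF bilin[OF assms(1)], of "X p" "D Y p h"]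
    by (simp add: sum.distrib[symmetric] algebra_simps)
  show ?thesis
    by (rule has_derivative_transform_eventually[OF *[unfolded eq]])
      (auto intro!: eventually_mono[OF ev] bilinear_expand[symmetric] bilin assms)
qed

lemma bilinear_D:
  assumes "y \<in> S"
  shows "bilinear (\<lambda>v w. D (\<lambda>z. \<Omega> z v w) y u)"
proof -
  have eq: "D (\<lambda>z. \<Omega> z v w) y u = D f y u"
    if "\<And>z. z \<in> S \<Longrightarrow> \<Omega> z v w = f z" for v w f
    using frechet_derivative_transform_within_open[OF diff[OF assms] open_S assms that] by metis
  have [simp]: "D (\<lambda>z. f z + h z) y u = D f y u + D h y u"
    if "f differentiable (at y)" "h differentiable (at y)" for f h :: "'e \<Rightarrow> real"
    by (simp add: D_eqI[OF has_derivative_add[OF has_D has_D]] that)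
  have [simp]: "D (\<lambda>z. c * f z) y u = c * D f y u" if "f differentiable (at y)"
    for c and f :: "'e \<Rightarrow> real"
    by (simp add: D_eqI[OF has_derivative_mult_right[OF has_D]] that)
  show ?thesis
    unfolding bilinear_def
  proof (intro conjI allI linearI)
    fix x v w :: 'e and c :: real
    show "D (\<lambda>z. \<Omega> z (v + w) x) y u = D (\<lambda>z. \<Omega> z v x) y u + D (\<lambda>z. \<Omega> z w x) y u"
      by (subst eq[of _ _ "\<lambda>z. \<Omega> z v x + \<Omega> z w x"]) (auto simp: bilinear_ladd bilin diff assms)
    show "D (\<lambda>z. \<Omega> z x (v + w)) y u = D (\<lambda>z. \<Omega> z x v) y u + D (\<lambda>z. \<Omega> z x w) y u"
      by (subst eq[of _ _ "\<lambda>z. \<Omega> z x v + \<Omega> z x w"]) (auto simp: bilinear_radd bilin diff assms)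
    show "D (\<lambda>z. \<Omega> z (c *\<^sub>R v) x) y u = c *\<^sub>R D (\<lambda>z. \<Omega> z v x) y u"
      by (subst eq[of _ _ "\<lambda>z. c * \<Omega> z v x"]) (auto simp: bilinear_lmul bilin diff assms)
    show "D (\<lambda>z. \<Omega> z x (c *\<^sub>R v)) y u = c *\<^sub>R D (\<lambda>z. \<Omega> z x v) y u"
      by (subst eq[of _ _ "\<lambda>z. c * \<Omega> z x v"]) (auto simp: bilinear_rmul bilin diff assms)
  qed
qed

lemma D_contract:
  assumes "y \<in> S" "X differentiable (at y)"
  shows "D (\<lambda>z. \<Omega> z (X z) w) y u = D (\<lambda>z. \<Omega> z (X y) w) y u + \<Omega> y (D X y u) w"
    and "(\<lambda>z. \<Omega> z (X z) w) differentiable (at y)"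
proof -
  have h: "((\<lambda>q. \<Omega> q (X q) w) has_derivative
    (\<lambda>h. D (\<lambda>z. \<Omega> z (X y) w) y h + \<Omega> y (D X y h) w + \<Omega> y (X y) 0)) (at y)"
    using has_derivative_along[of "\<lambda>z. z" y X "\<lambda>_. w"] assms by simp
  from D_eqI[OF h] show "D (\<lambda>z. \<Omega> z (X z) w) y u = D (\<lambda>z. \<Omega> z (X y) w) y u + \<Omega> y (D X y u) w"
    by (simp add: bilinear_rzero[OF bilin[OF assms(1)]])
  show "(\<lambda>z. \<Omega> z (X z) w) differentiable (at y)" using h by (rule differentiableI)
qed

(* Cartan's formula: d(i_X \<Omega>) = L_X \<Omega>, as d\<Omega> = 0. *)
lemma cartan:
  assumes "y \<in> S" "X differentiable (at y)"
    and skew: "\<And>z v w. z \<in> S \<Longrightarrow> \<Omega> z v w = - \<Omega> z w v"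
    and closed: "\<And>u v w. D (\<lambda>z. \<Omega> z v w) y u + D (\<lambda>z. \<Omega> z w u) y v + D (\<lambda>z. \<Omega> z u v) y w = 0"
  shows "D (\<lambda>z. \<Omega> z (X z) w) y u - D (\<lambda>z. \<Omega> z (X z) u) y w
    = D (\<lambda>z. \<Omega> z u w) y (X y) + \<Omega> y (D X y u) w + \<Omega> y u (D X y w)"
proof -
  have D_skew: "D (\<lambda>z. \<Omega> z v w) y u = - D (\<lambda>z. \<Omega> z w v) y u" for u v w
  proof -
    have "D (\<lambda>z. \<Omega> z v w) y = D (\<lambda>z. - \<Omega> z w v) y"
      by (rule frechet_derivative_transform_within_open[OF diff[OF assms(1)] open_S assms(1)])
        (rule skew)
    also have "\<dots> = (\<lambda>u. - D (\<lambda>z. \<Omega> z w v) y u)"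
      by (rule D_eqI[OF has_derivative_minus[OF has_D[OF diff[OF assms(1)]]]])
    finally show ?thesis by simp
  qed
  show ?thesis
    using closed[of "X y" w u] D_skew[of w u "X y"] D_skew[of u "X y" w] skew[OF assms(1), of "D X y w" u]
    by (simp add: D_contract(1)[OF assms(1,2)])
qed

end

lemma endo_field_differentiable:
  fixes K :: "'e::euclidean_space \<Rightarrow> 'e \<Rightarrow> 'e"
  assumes "open S" "y \<in> S" "\<And>z. z \<in> S \<Longrightarrow> linear (K z)"
    and "\<And>v. (\<lambda>z. K z v) differentiable (at y)" "X differentiable (at y)"
  shows "(\<lambda>z. K z (X z)) differentiable (at y)"
proof (rule differentiable_transform_open)
  show "(\<lambda>z. \<Sum>i\<in>Basis. (X z \<bullet> i) *\<^sub>R K z i) differentiable (at y)"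
    using assms(4,5) by (intro differentiable_sum differentiable_scaleR differentiable_inner) auto
  show "(\<Sum>i\<in>Basis. (X z \<bullet> i) *\<^sub>R K z i) = K z (X z)" if "z \<in> S" for z
  proof -
    have "K z (\<Sum>i\<in>Basis. (X z \<bullet> i) *\<^sub>R i) = (\<Sum>i\<in>Basis. (X z \<bullet> i) *\<^sub>R K z i)"
      using assms(3)[OF that] by (simp add: linear_sum linear_cmul)
    then show ?thesis by (simp add: euclidean_representation)
  qed
qed (use assms in auto)

section \<open>Levi-Civita divergence in coordinates\<close>

locale local_metric = bilinear_field S G for S and G :: "'e::euclidean_space \<Rightarrow> 'e \<Rightarrow> 'e \<Rightarrow> real" +
  assumes G_sym: "y \<in> S \<Longrightarrow> G y v w = G y w v" and G_pos: "y \<in> S \<Longrightarrow> v \<noteq> 0 \<Longrightarrow> G y v v > 0"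
begin

lemma inner_form: "y \<in> S \<Longrightarrow> inner_form (G y)"
  by (simp add: inner_form_def bilin G_sym G_pos)

text \<open>The right-hand side of the Koszul formula is linear in \<open>w\<close>, so exactly one
  vector represents it, and the \<open>THE\<close> in the definition is justified.\<close>

lemma christoffel:
  assumes "y \<in> S"
  shows "2 * G y (christoffel G y u v) w = D (\<lambda>z. G z v w) y u + D (\<lambda>z. G z u w) y v - D (\<lambda>z. G z u v) y w"
proof -
  have "linear (\<lambda>w. (1 / 2) *\<^sub>R (D (\<lambda>z. G z v w) y u + D (\<lambda>z. G z u w) y v - D (\<lambda>z. G z u v) y w))"
    (is "linear ?\<phi>")
    using bilinear_D[OF assms] linear_frechet_derivative[OF diff[OF assms]]
    by (intro linear_compose_scale_right linear_compose_add linear_compose_sub) (auto simp: bilinear_def)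
  note rep = inner_form.representable[OF inner_form[OF assms] this]
  have "(2 * G y z w = D (\<lambda>z. G z v w) y u + D (\<lambda>z. G z u w) y v - D (\<lambda>z. G z u v) y w) \<longleftrightarrow> G y z w = ?\<phi> w" for z w
    by auto
  with rep have "\<exists>!z. \<forall>w. 2 * G y z w = D (\<lambda>z. G z v w) y u + D (\<lambda>z. G z u w) y v - D (\<lambda>z. G z u v) y w"
    by simp
  from theI'[OF this] show ?thesis by (simp add: christoffel_def)
qed

lemma linear_christoffel:
  assumes "y \<in> S"
  shows "linear (\<lambda>u. christoffel G y u v)" "linear (christoffel G y u)"
proof -
  have l: "linear (\<lambda>v. D (\<lambda>z. G z v w) y u)" "linear (\<lambda>w. D (\<lambda>z. G z v w) y u)"
    "linear (D (\<lambda>z. G z v w) y)" for u v w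
    using bilinear_D[OF assms, of u] linear_frechet_derivative[OF diff[OF assms]]
    by (auto simp: bilinear_def)
  have eq: "G y (christoffel G y u v) w = (1 / 2) *\<^sub>R (D (\<lambda>z. G z v w) y u + D (\<lambda>z. G z u w) y v - D (\<lambda>z. G z u v) y w)" for u v w
    using christoffel[OF assms, of u v w] by simp
  show "linear (\<lambda>u. christoffel G y u v)"
    by (rule inner_form.linear_representing[OF inner_form[OF assms] eq])
      (intro linear_compose_scale_right linear_compose_add linear_compose_sub l)
  show "linear (christoffel G y u)"
    by (rule inner_form.linear_representing[OF inner_form[OF assms] eq])
      (intro linear_compose_scale_right linear_compose_add linear_compose_sub l)
qed

lemma local_divergence_eq_tr:
  "local_divergence G X y = tr (\<lambda>u. D X y u + christoffel G y u (X y))"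
  by (simp add: local_divergence_def tr_def)

lemma local_divergence_sum:
  assumes "y \<in> S" "\<And>i. i \<in> I \<Longrightarrow> X i differentiable (at y)"
  shows "local_divergence G (\<lambda>z. \<Sum>i\<in>I. q i *\<^sub>R X i z) y = (\<Sum>i\<in>I. q i * local_divergence G (X i) y)"
proof -
  have "((\<lambda>z. \<Sum>i\<in>I. q i *\<^sub>R X i z) has_derivative (\<lambda>u. \<Sum>i\<in>I. q i *\<^sub>R D (X i) y u)) (at y)"
    by (intro has_derivative_sum has_derivative_scaleR_right has_D assms)
  from D_eqI[OF this] show ?thesis
    by (simp add: local_divergence_def linear_sum[OF linear_christoffel(2)[OF assms(1)]]
        linear_cmul[OF linear_christoffel(2)[OF assms(1)]] inner_add_left inner_sum_left
        sum.distrib sum_distrib_left sum.swap[of _ I Basis] distrib_left)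
qed

(* Since 2 * christoffel G y _ x is G-skew up to the endomorphism representing the derivative of G
   along x, the divergence is that of the Riemannian volume density. *)
lemma tr_christoffel:
  assumes "y \<in> S" "linear p" "\<And>u w. G y (p u) w = D (\<lambda>z. G z u w) y x"
  shows "2 * tr (\<lambda>u. christoffel G y u x) = tr p"
proof -
  interpret inner_form "G y" by (rule inner_form[OF assms(1)])
  define a where "a u = 2 *\<^sub>R christoffel G y u x + - p u" for u
  have lin_a: "linear a" unfolding a_def
    by (intro linear_compose_add linear_compose_neg linear_compose_scale_right
        linear_christoffel(1)[OF assms(1)] assms(2))
  have D_sym: "D (\<lambda>z. G z v w) y u = D (\<lambda>z. G z w v) y u" for u v w
    using frechet_derivative_transform_within_open[OF diff[OF assms(1)] open_S assms(1) G_sym]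
    by metis
  have a: "G y (a u) w = D (\<lambda>z. G z x w) y u - D (\<lambda>z. G z u x) y w" for u w
    using christoffel[OF assms(1), of u x w]
    by (simp add: a_def bilinear_lsub[OF bilin] bilinear_lmul[OF bilin] assms(3))
  \<comment> \<open>The remaining two derivatives are exchanged with opposite sign when
    \<open>u\<close> and \<open>w\<close> are, so \<open>a\<close> is G-skew; its adjoint
    \<open>- a\<close> has the same trace, which is therefore 0.\<close>
  have "G y (a u) v = G y u (- a v)" for u v
    by (simp add: bilinear_rneg[OF bilin] sym[of u] a D_sym[of x])
  then have "tr a = tr (\<lambda>u. - a u)"
    by (intro tr_eq_of_adjoint linear_compose_neg lin_a)
  then have "tr a = 0" by (simp add: tr_uminus)
  moreover have "tr a = 2 * tr (\<lambda>u. christoffel G y u x) + - tr p"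
    unfolding a_def[abs_def] by (simp only: tr_add tr_uminus tr_scaleR)
  ultimately show ?thesis by simp
qed

end

(* X preserves the symplectic form G(K _, _), hence its Liouville volume. As K is orthogonal, this
   is the Riemannian volume, so X is divergence-free. *)
lemma (in local_metric) divergence_symplectic:
  assumes y: "y \<in> S"
    and K: "\<And>z. z \<in> S \<Longrightarrow> linear (K z)" "\<And>z v. z \<in> S \<Longrightarrow> K z (K z v) = - v"
      "\<And>z v. z \<in> S \<Longrightarrow> (\<lambda>z. K z v) differentiable (at z)"
    and skew: "\<And>z v w. z \<in> S \<Longrightarrow> G z (K z v) w = - G z (K z w) v"
    and closed: "\<And>u v w. D (\<lambda>z. G z (K z v) w) y u + D (\<lambda>z. G z (K z w) u) y v
      + D (\<lambda>z. G z (K z u) v) y w = 0"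
    and X: "X differentiable (at y)"
    and closed_X: "\<And>u w. D (\<lambda>z. G z (K z (X z)) w) y u = D (\<lambda>z. G z (K z (X z)) u) y w"
  shows "local_divergence G X y = 0"
proof -
  interpret y: inner_form "G y" by (rule inner_form[OF y])
  interpret \<omega>: bilinear_field S "\<lambda>z v w. G z (K z v) w"
  proof
    show "bilinear (\<lambda>v w. G z (K z v) w)" if "z \<in> S" for z
      using bilin[OF that] K(1)[OF that] linear_compose[OF K(1)[OF that], of "\<lambda>v. G z v _"]
      by (auto simp: bilinear_def o_def)
    show "(\<lambda>z. G z (K z v) w) differentiable (at z)" if "z \<in> S" for z v w
      using D_contract(2)[OF that K(3)[OF that]] .
  qed (rule open_S)
  \<comment> \<open>Pairing \<open>K\<close> with fixed vectors turns it into a field of forms, so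
    that the composite K(K u) can be differentiated by \<open>D_contract\<close>.\<close>
  interpret k: bilinear_field S "\<lambda>z v w. K z v \<bullet> w"
  proof
    show "bilinear (\<lambda>v w. K z v \<bullet> w)" if "z \<in> S" for z
      using K(1)[OF that] by (auto simp: bilinear_def linear_iff inner_add_left inner_add_right)
    show "(\<lambda>z. K z v \<bullet> w) differentiable (at z)" if "z \<in> S" for z v w
      using K(3)[OF that] by (intro differentiable_inner) auto
  qed (rule open_S)
  define x M where "x = X y" and "M = D X y"
  define k where "k u = D (\<lambda>z. K z u) y x" for u
  have lin: "linear (K y)" "linear M"
    using K(1) y linear_frechet_derivative[OF X] by (auto simp: M_def)
  have kw: "D (\<lambda>z. K z u \<bullet> w) y x = k u \<bullet> w" for u w
    using D_eqI[OF bounded_linear.has_derivative[OF bounded_linear_inner_left has_D[OF K(3)[OF y]]]]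
    by (simp add: k_def)
  have lin_k: "linear k"
  proof (rule linearI)
    have l: "linear (\<lambda>u. k u \<bullet> w)" for w
      using k.bilinear_D[OF y, of x] by (simp add: kw bilinear_def)
    show "k (u + v) = k u + k v" for u v
      by (rule vector_eq_rdot[THEN iffD1]) (use linear_add[OF l] in \<open>auto simp: inner_add_left\<close>)
    show "k (c *\<^sub>R u) = c *\<^sub>R k u" for c u
      by (rule vector_eq_rdot[THEN iffD1]) (use linear_cmul[OF l] in auto)
  qed
  \<comment> \<open>Differentiate K^2 = -1 along \<open>x\<close>. By cyclicity of the trace the
    composite of \<open>k\<close> and \<open>K\<close> is then traceless, which is the infinitesimal
    form of the constancy of det K and makes the Liouville and Riemannian volumes agree.\<close>
  have kK: "k (K y u) = - K y (k u)" for u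
  proof (rule vector_eq_rdot[THEN iffD1], rule allI)
    fix w
    have "D (\<lambda>z. K z (K z u) \<bullet> w) y x = D (\<lambda>z. (- u) \<bullet> w) y x"
      by (rule fun_cong[OF frechet_derivative_transform_within_open[OF _ open_S y]])
        (use k.D_contract(2)[OF y K(3)[OF y]] K(2) in auto)
    then show "k (K y u) \<bullet> w = (- K y (k u)) \<bullet> w"
      using k.D_contract(1)[OF y K(3)[OF y], of u w x] by (simp add: kw k_def)
  qed
  have "tr (\<lambda>u. k (K y u)) = - tr (\<lambda>u. k (K y u))"
    using tr_comp_commute[OF lin_k lin(1)] by (simp add: kK tr_uminus)
  then have tr_kK: "tr (\<lambda>u. k (K y u)) = 0" by simp
  obtain p where p: "linear p" "\<And>u w. G y (p u) w = D (\<lambda>z. G z u w) y x"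
    using y.bilinear_representable[OF bilinear_D[OF y]] by metis
  \<comment> \<open>Cartan's formula read backwards: the contraction with \<open>X\<close> is
    closed, so the Lie derivative of G(K _, _) along \<open>X\<close> vanishes at
    \<open>y\<close>.\<close>
  have lie: "D (\<lambda>z. G z (K z u) w) y x + G y (K y (M u)) w + G y (K y u) (M w) = 0" for u w
    using \<omega>.cartan[OF y X skew closed, of w u] closed_X[of w u] by (simp add: x_def M_def)
  have lie': "G y (p (K y u)) w + G y (k u) w + G y (K y (M u)) w + G y (K y u) (M w) = 0" for u w
    using lie[of u w] D_contract(1)[OF y K(3)[OF y], of u w x] by (simp add: p(2) k_def)
  \<comment> \<open>Replacing \<open>u\<close> by \<open>K y u\<close> removes \<open>K\<close> from
    the last term of \<open>lie'\<close>, since K^2 = -1. What remains exhibits the G-adjoint of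
    \<open>M\<close>. On taking traces, K M K contributes -tr M, so tr p = -2 tr M.\<close>
  have "G y (- p u + k (K y u) + K y (M (K y u))) w = G y u (M w)" for u w
    using lie'[of "K y u" w]
    by (simp add: K(2)[OF y] linear_neg[OF p(1)] bilinear_ladd[OF bilin[OF y]] bilinear_lneg[OF bilin[OF y]]
        bilinear_lsub[OF bilin[OF y]])
  then have "tr (\<lambda>u. - p u + k (K y u) + K y (M (K y u))) = tr M"
    by (rule y.tr_eq_of_adjoint[OF lin(2)])
  moreover have "tr (\<lambda>u. K y (M (K y u))) = - tr M"
    using tr_comp_commute[OF lin(1) linear_compose[OF lin(1) lin(2)]]
    by (simp add: o_def K(2)[OF y] linear_neg[OF lin(2)] tr_uminus)
  moreover have "tr (\<lambda>u. - p u + k (K y u) + K y (M (K y u)))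
    = - tr p + tr (\<lambda>u. k (K y u)) + tr (\<lambda>u. K y (M (K y u)))"
    by (simp only: tr_add tr_uminus)
  ultimately have "tr p = - 2 * tr M"
    using tr_kK by linarith
  then have "tr (\<lambda>u. christoffel G y u x) = - tr M"
    using tr_christoffel[OF y p] by simp
  then show ?thesis
    by (simp add: local_divergence_eq_tr tr_add flip: x_def M_def)
qed

section \<open>Charts\<close>

lemma
  assumes "is_chart c"
  shows open_chart: "open (fst c)"
    and open_chart_image: "open (chart_image c)"
    and continuous_on_chart: "continuous_on (fst c) (snd c)"
    and continuous_on_chart_inv: "continuous_on (chart_image c) (chart_inv c)"
    and chart_inv_chart: "x \<in> fst c \<Longrightarrow> chart_inv c (snd c x) = x"
  using assms by (auto simp: is_chart_def homeomorphism_def)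

lemma chart_inv_in: "y \<in> chart_image c \<Longrightarrow> chart_inv c y \<in> fst c"
  by (rule inv_into_into)

lemma chart_chart_inv: "y \<in> chart_image c \<Longrightarrow> snd c (chart_inv c y) = y"
  by (rule f_inv_into_f)

lemma isCont_chart_inv: "is_chart c \<Longrightarrow> y \<in> chart_image c \<Longrightarrow> isCont (chart_inv c) y"
  using continuous_on_chart_inv open_chart_image continuous_on_eq_continuous_at by blast

text \<open>The chain rule for a composite passing through the manifold. Continuity keeps
  \<open>\<phi>\<close> inside the domain of \<open>d\<close> near \<open>p\<close>, where the chart
  followed by its inverse can be inserted.\<close>

lemma has_derivative_through_chart:
  assumes "is_chart d" "isCont \<phi> p" "\<phi> p \<in> fst d"
    and "(snd d \<circ> \<phi>) differentiable (at p)"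
    and "(\<psi> \<circ> chart_inv d) differentiable (at (snd d (\<phi> p)))"
  shows "((\<psi> \<circ> \<phi>) has_derivative (\<lambda>u. D (\<psi> \<circ> chart_inv d) (snd d (\<phi> p)) (D (snd d \<circ> \<phi>) p u))) (at p)"
proof -
  have ev: "eventually (\<lambda>q. \<phi> q \<in> fst d) (at p)"
    using topological_tendstoD[OF _ open_chart[OF assms(1)] assms(3)] assms(2)
    by (simp add: isCont_def)
  have "(((\<psi> \<circ> chart_inv d) \<circ> (snd d \<circ> \<phi>)) has_derivative
      (D (\<psi> \<circ> chart_inv d) ((snd d \<circ> \<phi>) p) \<circ> D (snd d \<circ> \<phi>) p)) (at p)"
    using assms(4,5) by (intro diff_chain_at has_D) auto
  then have "(((\<psi> \<circ> chart_inv d) \<circ> (snd d \<circ> \<phi>)) has_derivative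
      (\<lambda>u. D (\<psi> \<circ> chart_inv d) (snd d (\<phi> p)) (D (snd d \<circ> \<phi>) p u))) (at p)"
    by (simp add: o_def)
  then show ?thesis
    by (rule has_derivative_transform_eventually)
      (use ev assms(1,3) in \<open>auto elim!: eventually_mono simp: chart_inv_chart\<close>)
qed

locale smooth_manifold =
  fixes A :: "('m::{second_countable_topology,t2_space}, 'e::euclidean_space) chart set"
  assumes atlas: "smooth_atlas A"
begin

lemma chart: "c \<in> A \<Longrightarrow> is_chart c"
  using atlas by (simp add: smooth_atlas_def)

lemma chart_at: "chart_at A x \<in> A" "x \<in> fst (chart_at A x)"
proof -
  have "x \<in> (\<Union>c\<in>A. fst c)" using atlas by (simp add: smooth_atlas_def)
  then have "\<exists>c. c \<in> A \<and> x \<in> fst c" by blast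
  from someI_ex[OF this] show "chart_at A x \<in> A" "x \<in> fst (chart_at A x)"
    by (simp_all add: chart_at_def)
qed

lemma transition_differentiable:
  assumes "c \<in> A" "d \<in> A" "x \<in> fst c" "x \<in> fst d"
  shows "(snd d \<circ> chart_inv c) differentiable (at (snd c x))"
  using atlas assms by (intro smooth_on_differentiable) (auto simp: smooth_atlas_def)

lemma linear_from_coords: "c \<in> A \<Longrightarrow> x \<in> fst c \<Longrightarrow> linear (from_coords A c x)"
  unfolding from_coords_def by (intro linear_frechet_derivative transition_differentiable chart_at)

lemma linear_to_coords: "c \<in> A \<Longrightarrow> x \<in> fst c \<Longrightarrow> linear (to_coords A c x)"
  unfolding to_coords_def by (intro linear_frechet_derivative transition_differentiable chart_at)

text \<open>The identity of the image of \<open>c\<close> is factored through \<open>d\<close>, and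
  the chain rule is compared with the derivative of the identity.\<close>

lemma transition_inverse:
  assumes "c \<in> A" "d \<in> A" "x \<in> fst c" "x \<in> fst d"
  shows "D (snd c \<circ> chart_inv d) (snd d x) (D (snd d \<circ> chart_inv c) (snd c x) v) = v"
proof -
  have x: "chart_inv c (snd c x) = x" using assms chart chart_inv_chart by blast
  have "((snd c \<circ> chart_inv c) has_derivative
     (\<lambda>u. D (snd c \<circ> chart_inv d) (snd d x) (D (snd d \<circ> chart_inv c) (snd c x) u))) (at (snd c x))"
    using has_derivative_through_chart[of d "snd c x" "chart_inv c" "snd c"] assms chart
      isCont_chart_inv[of c "snd c x"] transition_differentiable x by simp
  moreover have "((snd c \<circ> chart_inv c) has_derivative (\<lambda>u. u)) (at (snd c x))"
    by (rule has_derivative_transform_within_open[OF has_derivative_ident open_chart_image[of c]])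
      (use assms chart in \<open>auto simp: chart_chart_inv chart_inv_chart\<close>)
  ultimately show ?thesis
    using has_derivative_unique by (metis (no_types, lifting))
qed

lemma to_from_coords: "c \<in> A \<Longrightarrow> x \<in> fst c \<Longrightarrow> to_coords A c x (from_coords A c x v) = v"
  unfolding from_coords_def to_coords_def by (intro transition_inverse chart_at)

lemma from_to_coords: "c \<in> A \<Longrightarrow> x \<in> fst c \<Longrightarrow> from_coords A c x (to_coords A c x v) = v"
  unfolding from_coords_def to_coords_def by (intro transition_inverse chart_at)

section \<open>Differentials of functions and first cohomology\<close>

lemma smooth_fun_differentiable:
  "smooth_fun A f \<Longrightarrow> c \<in> A \<Longrightarrow> x \<in> fst c \<Longrightarrow> (f \<circ> chart_inv c) differentiable (at (snd c x))"
  by (rule smooth_on_differentiable[of "chart_image c"]) (auto simp: smooth_fun_def)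

text \<open>Frees \<open>differential\<close> from the selected chart: its components in any chart
  of the atlas are the ordinary partial derivatives.\<close>

lemma differential_from_coords:
  assumes "smooth_fun A f" "c \<in> A" "x \<in> fst c"
  shows "differential A f x (from_coords A c x u) = D (f \<circ> chart_inv c) (snd c x) u"
proof -
  have x: "chart_inv c (snd c x) = x" using assms chart chart_inv_chart by blast
  have "((f \<circ> chart_inv c) has_derivative (\<lambda>u. D (f \<circ> chart_inv (chart_at A x)) (snd (chart_at A x) x)
      (D (snd (chart_at A x) \<circ> chart_inv c) (snd c x) u))) (at (snd c x))"
    using has_derivative_through_chart[of "chart_at A x" "snd c x" "chart_inv c" f] assms chart
      isCont_chart_inv[of c "snd c x"] transition_differentiable[of c "chart_at A x" x] x
      chart_at[of x] smooth_fun_differentiable[OF assms(1) chart_at(1) chart_at(2)] by simp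
  from D_eqI[OF this] show ?thesis by (simp add: differential_def from_coords_def)
qed

lemma differential_sum:
  assumes "\<And>i. i \<in> I \<Longrightarrow> smooth_fun A (f i)"
  shows "smooth_fun A (\<lambda>x. \<Sum>i\<in>I. a i * f i x)"
    and "differential A (\<lambda>x. \<Sum>i\<in>I. a i * f i x) x v = (\<Sum>i\<in>I. a i * differential A (f i) x v)"
proof -
  show "smooth_fun A (\<lambda>x. \<Sum>i\<in>I. a i * f i x)"
    unfolding smooth_fun_def o_def
  proof
    fix c assume c: "c \<in> A"
    show "smooth_on (chart_image c) (\<lambda>x. \<Sum>i\<in>I. a i * f i (chart_inv c x))"
      by (intro smooth_on_sum open_chart_image[OF chart[OF c]]
          smooth_on_linear[OF _ bounded_linear_mult_right])
        (use assms c in \<open>auto simp: smooth_fun_def o_def\<close>)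
  qed
  have "((\<lambda>y. \<Sum>i\<in>I. a i * (f i \<circ> chart_inv (chart_at A x)) y) has_derivative
      (\<lambda>v. \<Sum>i\<in>I. a i * differential A (f i) x v)) (at (snd (chart_at A x) x))"
    unfolding differential_def
    by (intro has_derivative_sum has_derivative_mult_right has_D smooth_fun_differentiable assms chart_at)
  from D_eqI[OF this]
  show "differential A (\<lambda>x. \<Sum>i\<in>I. a i * f i x) x v = (\<Sum>i\<in>I. a i * differential A (f i) x v)"
    by (simp add: differential_def o_def)
qed

text \<open>A closed form that is not exact is by itself a one-element set independent modulo exact
  forms, which would make the Betti number at least 1.\<close>

lemma closed_1form_exact:
  assumes "first_betti_number A = 0" "closed_1form A \<alpha>"
  shows "exact_1form A \<alpha>"
proof (rule ccontr)
  assume not_exact: "\<not> exact_1form A \<alpha>"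
  have "a \<alpha> = 0" if exact: "exact_1form A (\<lambda>x v. \<Sum>\<alpha>\<in>{\<alpha>}. a \<alpha> * \<alpha> x v)" for a :: "_ \<Rightarrow> real"
  proof (rule ccontr)
    assume a: "a \<alpha> \<noteq> 0"
    obtain f where f: "smooth_fun A f" "(\<lambda>x v. a \<alpha> * \<alpha> x v) = differential A f"
      using exact by (auto simp: exact_1form_def)
    have "\<alpha> x v = (1 / a \<alpha>) * differential A f x v" for x v
      using fun_cong[OF fun_cong[OF f(2)], of x v] a by (simp add: field_simps)
    \<comment> \<open>A sum over the one-element set of units presents a scalar multiple as an
      instance of \<open>differential_sum\<close>.\<close>
    then have "\<alpha> x v = differential A (\<lambda>x. \<Sum>i\<in>{()}. (1 / a \<alpha>) * f x) x v" for x v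
      using differential_sum(2)[of "{()}" "\<lambda>_. f" "\<lambda>_. 1 / a \<alpha>" x v] f(1) by simp
    then have "exact_1form A \<alpha>"
      using differential_sum(1)[of "{()}" "\<lambda>_. f" "\<lambda>_. 1 / a \<alpha>"] f(1) unfolding exact_1form_def by blast
    with not_exact show False ..
  qed
  then have "enat (card {\<alpha>}) \<le> first_betti_number A"
    unfolding first_betti_number_def using assms(2) by (intro SUP_upper) auto
  then show False using assms(1) by (simp add: zero_enat_def)
qed

section \<open>Tensor fields in a fixed chart\<close>

lemma smooth_bilinear_field:
  assumes "c \<in> A" "\<And>x. bilinear (\<omega> x)"
    and "\<And>v w. smooth_on (chart_image c) (\<lambda>y. local_bilinear A c \<omega> y v w)"
  shows "bilinear_field (chart_image c) (local_bilinear A c \<omega>)"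
proof
  show "open (chart_image c)" by (rule open_chart_image[OF chart[OF assms(1)]])
  show "(\<lambda>z. local_bilinear A c \<omega> z v w) differentiable (at y)" if "y \<in> chart_image c" for y v w
    by (rule smooth_on_differentiable[OF assms(3) that])
  show "bilinear (local_bilinear A c \<omega> y)" if "y \<in> chart_image c" for y
    using assms(2) linear_from_coords[OF assms(1) chart_inv_in[OF that]]
    by (auto simp: bilinear_def local_bilinear_def Let_def linear_iff)
qed

lemma riemannian_local_metric:
  assumes "c \<in> A" "riemannian_metric A g"
  shows "local_metric (chart_image c) (local_bilinear A c g)"
proof -
  interpret bilinear_field "chart_image c" "local_bilinear A c g"
    using assms by (intro smooth_bilinear_field) (auto simp: riemannian_metric_def)
  show ?thesis
  proof
    fix y v w assume y: "y \<in> chart_image c"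
    show "local_bilinear A c g y v w = local_bilinear A c g y w v"
      using assms(2) by (simp add: local_bilinear_def Let_def riemannian_metric_def)
    assume "(v :: 'e) \<noteq> 0"
    then have "from_coords A c (chart_inv c y) v \<noteq> 0"
      using to_from_coords[OF assms(1) chart_inv_in[OF y], of v]
        linear_0[OF linear_to_coords[OF assms(1) chart_inv_in[OF y]]] by metis
    then show "local_bilinear A c g y v v > 0"
      using assms(2) by (simp add: local_bilinear_def Let_def riemannian_metric_def)
  qed
qed

lemma linear_local_endo:
  assumes "c \<in> A" "y \<in> chart_image c" "\<And>x. linear (J x)"
  shows "linear (local_endo A c J y)"
  using linear_compose[OF linear_compose[OF linear_from_coords assms(3)] linear_to_coords]
    assms(1) chart_inv_in[OF assms(2)]
  by (simp add: local_endo_def[abs_def] Let_def o_def)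

lemma local_endo_compose:
  assumes "c \<in> A" "y \<in> chart_image c"
  shows "local_endo A c J y (local_endo A c K y v) = local_endo A c (\<lambda>x v. J x (K x v)) y v"
  by (simp add: local_endo_def Let_def from_to_coords[OF assms(1) chart_inv_in[OF assms(2)]])

lemma local_bilinear_kaehler_form:
  assumes "c \<in> A" "y \<in> chart_image c"
  shows "local_bilinear A c (kaehler_form g J) y v w = local_bilinear A c g y (local_endo A c J y v) w"
  by (simp add: local_bilinear_def local_endo_def kaehler_form_def Let_def
      from_to_coords[OF assms(1) chart_inv_in[OF assms(2)]])

end

text \<open>The map read from \<open>c\<close> into the selected chart at \<open>f x\<close> factors
  in two ways, through \<open>d\<close> on the target side and through the selected chart at
  \<open>x\<close> on the source side. Uniqueness of derivatives equates the two chain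
  rules.\<close>

lemma tangent_map_from_coords:
  assumes "smooth_manifold A" "smooth_manifold B" "smooth_map A B f"
    and "c \<in> A" "x \<in> fst c" "d \<in> B" "f x \<in> fst d"
  shows "(snd d \<circ> f \<circ> chart_inv c) differentiable (at (snd c x))"
    and "from_coords B d (f x) (D (snd d \<circ> f \<circ> chart_inv c) (snd c x) u)
      = tangent_map A B f x (from_coords A c x u)"
proof -
  interpret A: smooth_manifold A by fact
  interpret B: smooth_manifold B by fact
  have diff: "(snd d \<circ> f \<circ> chart_inv c) differentiable (at (snd c x))"
    if "c \<in> A" "x \<in> fst c" "d \<in> B" "f x \<in> fst d" for c d
    by (rule smooth_on_differentiable[of "snd c ` (fst c \<inter> f -` fst d)"])
      (use assms(3) that in \<open>auto simp: smooth_map_def\<close>)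
  show "(snd d \<circ> f \<circ> chart_inv c) differentiable (at (snd c x))" using diff assms by blast
  define c' d' where "c' = chart_at A x" and "d' = chart_at B (f x)"
  have c': "c' \<in> A" "x \<in> fst c'" and d': "d' \<in> B" "f x \<in> fst d'"
    by (simp_all add: c'_def d'_def A.chart_at B.chart_at)
  have x: "chart_inv c (snd c x) = x" using assms A.chart chart_inv_chart by blast
  have cont: "isCont (chart_inv c) (snd c x)"
    using assms A.chart isCont_chart_inv by blast
  then have cont_f: "isCont (f \<circ> chart_inv c) (snd c x)"
    using assms(3) by (intro continuous_at_compose) (auto simp: smooth_map_def continuous_on_eq_continuous_at)
  have 1: "((snd d' \<circ> (f \<circ> chart_inv c)) has_derivative
     (\<lambda>u. D (snd d' \<circ> chart_inv d) (snd d (f x)) (D (snd d \<circ> (f \<circ> chart_inv c)) (snd c x) u))) (at (snd c x))"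
    using has_derivative_through_chart[of d "snd c x" "f \<circ> chart_inv c" "snd d'"] assms B.chart cont_f x
      diff[OF assms(4-7)] B.transition_differentiable[OF assms(6) d'(1) assms(7) d'(2)]
    by (simp add: o_assoc)
  have 2: "(((snd d' \<circ> f) \<circ> chart_inv c) has_derivative
     (\<lambda>u. D ((snd d' \<circ> f) \<circ> chart_inv c') (snd c' x) (D (snd c' \<circ> chart_inv c) (snd c x) u))) (at (snd c x))"
    using has_derivative_through_chart[of c' "snd c x" "chart_inv c" "snd d' \<circ> f"] A.chart cont x c'
      diff[OF c' d'] A.transition_differentiable[OF assms(4) c'(1) assms(5) c'(2)]
    by simp
  show "from_coords B d (f x) (D (snd d \<circ> f \<circ> chart_inv c) (snd c x) u)
      = tangent_map A B f x (from_coords A c x u)"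
    using has_derivative_unique[OF 1[unfolded o_assoc] 2]
    by (auto simp: from_coords_def tangent_map_def c'_def d'_def dest: fun_cong)
qed

section \<open>Actions\<close>

definition invariant_form ::
  "('m, 'e::euclidean_space) chart set \<Rightarrow> ('t \<Rightarrow> 'm \<Rightarrow> 'm) \<Rightarrow> ('m \<Rightarrow> 'e \<Rightarrow> 'e \<Rightarrow> real) \<Rightarrow> bool" where
  "invariant_form A \<rho> \<omega> \<longleftrightarrow>
     (\<forall>t x v w. \<omega> (\<rho> t x) (tangent_map A A (\<rho> t) x v) (tangent_map A A (\<rho> t) x w) = \<omega> x v w)"

text \<open>Joint smoothness in \<open>action\<close> yields the local action below; smoothness of
  single translations is what \<open>tangent_map_from_coords\<close> asks for, and it comes with
  their being isometries.\<close>

locale action_on_manifold = A: smooth_manifold A + B: smooth_manifold B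
  for A :: "('m::{second_countable_topology,t2_space}, 'e::euclidean_space) chart set"
    and B :: "('t::{ab_group_add,second_countable_topology,t2_space}, 'k::euclidean_space) chart set" +
  fixes \<rho> :: "'t \<Rightarrow> 'm \<Rightarrow> 'm"
  assumes action: "smooth_action B A \<rho>"
    and smooth_translation: "smooth_map A A (\<rho> t)"
begin

definition "origin = snd (chart_at B 0) 0"

text \<open>The same chart \<open>c\<close> is used before and after acting, so only pairs whose
  image falls back into its domain are kept. They form a neighbourhood of all pairs with group
  coordinate \<open>origin\<close>.\<close>

definition "action_domain c = {(p, y). p \<in> chart_image (chart_at B 0) \<and> y \<in> chart_image c \<and>
    \<rho> (chart_inv (chart_at B 0) p) (chart_inv c y) \<in> fst c}"

definition "local_action c = (\<lambda>(p, y). snd c (\<rho> (chart_inv (chart_at B 0) p) (chart_inv c y)))"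

text \<open>The fundamental field in the fixed chart \<open>c\<close>. As a partial derivative of a
  jointly smooth map it is visibly smooth, whereas \<open>fundamental_field\<close> has values in
  charts that change with the point.\<close>

definition "local_field c v y = D (local_action c) (origin, y) (v, 0)"

lemma is_chart_B: "is_chart (chart_at B 0)"
  by (intro B.chart B.chart_at)

lemma origin: "origin \<in> chart_image (chart_at B 0)" "chart_inv (chart_at B 0) origin = 0"
  using B.chart_at[of 0] chart_inv_chart[OF is_chart_B] by (auto simp: origin_def)

lemma action_0: "\<rho> 0 x = x"
  using action by (simp add: smooth_action_def)

lemma continuous_action: "continuous_on UNIV (\<lambda>(t, x). \<rho> t x)"
  using action by (simp add: smooth_action_def smooth_map_def)

lemma open_action_domain:
  assumes "c \<in> A"
  shows "open (action_domain c)"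
proof -
  let ?b = "chart_at B 0"
  have "continuous_on (chart_image ?b \<times> chart_image c) (\<lambda>q. (chart_inv ?b (fst q), chart_inv c (snd q)))"
    by (intro continuous_on_Pair continuous_on_compose2[OF continuous_on_chart_inv]
        is_chart_B A.chart assms continuous_intros) auto
  from continuous_on_compose2[OF continuous_action this]
  have "continuous_on (chart_image ?b \<times> chart_image c) (\<lambda>q. \<rho> (chart_inv ?b (fst q)) (chart_inv c (snd q)))"
    by (simp add: case_prod_beta)
  then have "open ((\<lambda>q. \<rho> (chart_inv ?b (fst q)) (chart_inv c (snd q))) -` fst c
      \<inter> (chart_image ?b \<times> chart_image c))"
    using continuous_on_open_vimage[of "chart_image ?b \<times> chart_image c"]
      open_Times[OF open_chart_image open_chart_image] is_chart_B A.chart[OF assms] open_chart by blast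
  moreover have "action_domain c = (\<lambda>q. \<rho> (chart_inv ?b (fst q)) (chart_inv c (snd q))) -` fst c
      \<inter> (chart_image ?b \<times> chart_image c)"
    by (auto simp: action_domain_def)
  ultimately show ?thesis by simp
qed

lemma origin_in_action_domain: "c \<in> A \<Longrightarrow> y \<in> chart_image c \<Longrightarrow> (origin, y) \<in> action_domain c"
  using origin chart_inv_in[of y c] by (simp add: action_domain_def action_0)

lemma smooth_local_action:
  assumes "c \<in> A"
  shows "smooth_on (action_domain c) (local_action c)"
proof -
  let ?b = "chart_at B 0"
  let ?e = "(fst ?b \<times> fst c, map_prod (snd ?b) (snd c))"
  note left = chart_inv_chart[OF is_chart_B] chart_inv_chart[OF A.chart[OF assms]]
  \<comment> \<open>The inverse of a product chart is an \<open>inv_into\<close> on the product set;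
    injectivity is what splits it into the two inverses.\<close>
  have inv: "chart_inv ?e (snd ?b t, snd c x) = (t, x)" if "t \<in> fst ?b" "x \<in> fst c" for t x
  proof -
    have "inj_on (snd ?e) (fst ?e)"
      by (rule inj_on_inverseI[of _ "map_prod (chart_inv ?b) (chart_inv c)"]) (auto simp: left)
    from inv_into_f_f[OF this, of "(t, x)"] that show ?thesis by simp
  qed
  have dom: "snd ?e ` (fst ?e \<inter> (\<lambda>(t, x). \<rho> t x) -` fst c) = action_domain c" (is "?L = _")
  proof (intro equalityI subsetI)
    fix q assume "q \<in> ?L"
    then show "q \<in> action_domain c" by (auto simp: action_domain_def left)
  next
    fix q assume q: "q \<in> action_domain c"
    then obtain t x where "q = (snd ?b t, snd c x)" "t \<in> fst ?b" "x \<in> fst c"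
      by (auto simp: action_domain_def)
    moreover from this q have "\<rho> t x \<in> fst c" by (simp add: action_domain_def left)
    ultimately show "q \<in> ?L"
      by (intro image_eqI[of _ _ "(t, x)"]) auto
  qed
  have "?e \<in> prod_atlas B A"
    unfolding prod_atlas_def using B.chart_at(1) assms by blast
  then have "smooth_on (snd ?e ` (fst ?e \<inter> (\<lambda>(t, x). \<rho> t x) -` fst c))
      (snd c \<circ> (\<lambda>(t, x). \<rho> t x) \<circ> chart_inv ?e)"
    using action assms unfolding smooth_action_def smooth_map_def by blast
  then show ?thesis
    unfolding dom
  proof (rule smooth_on_cong[OF open_action_domain[OF assms], rotated])
    fix q assume "q \<in> action_domain c"
    then obtain t x where "q = (snd ?b t, snd c x)" "t \<in> fst ?b" "x \<in> fst c"
      by (auto simp: action_domain_def)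
    then show "(snd c \<circ> (\<lambda>(t, x). \<rho> t x) \<circ> chart_inv ?e) q = local_action c q"
      by (simp add: local_action_def inv left del: fst_conv snd_conv)
  qed
qed

lemma local_action_differentiable:
  "c \<in> A \<Longrightarrow> q \<in> action_domain c \<Longrightarrow> local_action c differentiable (at q)"
  using smooth_local_action smooth_on_differentiable by blast

lemma smooth_local_field:
  assumes "c \<in> A"
  shows "smooth_on (chart_image c) (local_field c v)"
  unfolding local_field_def
  by (rule smooth_on_slice[OF open_chart_image[OF A.chart[OF assms]] origin_in_action_domain[OF assms]])
    (simp_all add: smooth_on_D smooth_local_action assms)

lemma
  assumes "c \<in> A" "y \<in> chart_image c"
  shows orbit_differentiable:
    "(snd c \<circ> (\<lambda>t. \<rho> t (chart_inv c y)) \<circ> chart_inv (chart_at B 0)) differentiable (at origin)"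
    and local_field_eq_D: "local_field c v y
      = D (snd c \<circ> (\<lambda>t. \<rho> t (chart_inv c y)) \<circ> chart_inv (chart_at B 0)) origin v"
proof -
  have "((\<lambda>p. local_action c (p, y)) has_derivative (\<lambda>v. local_field c v y)) (at origin)"
    unfolding local_field_def
    by (intro has_derivative_slice_left local_action_differentiable origin_in_action_domain assms)
  then have *: "((snd c \<circ> (\<lambda>t. \<rho> t (chart_inv c y)) \<circ> chart_inv (chart_at B 0)) has_derivative
      (\<lambda>v. local_field c v y)) (at origin)"
    by (simp add: local_action_def o_def)
  then show "(snd c \<circ> (\<lambda>t. \<rho> t (chart_inv c y)) \<circ> chart_inv (chart_at B 0)) differentiable (at origin)"
    by (rule differentiableI)
  show "local_field c v y = D (snd c \<circ> (\<lambda>t. \<rho> t (chart_inv c y)) \<circ> chart_inv (chart_at B 0)) origin v"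
    using D_eqI[OF *] by simp
qed

lemma linear_fundamental_field: "linear (\<lambda>v. fundamental_field B A \<rho> v x)"
proof -
  have "chart_inv (chart_at A x) (snd (chart_at A x) x) = x"
    using A.chart_at A.chart chart_inv_chart by blast
  then have "(snd (chart_at A x) \<circ> (\<lambda>t. \<rho> t x) \<circ> chart_inv (chart_at B 0)) differentiable (at origin)"
    using orbit_differentiable[of "chart_at A x" "snd (chart_at A x) x"] A.chart_at by simp
  from linear_frechet_derivative[OF this] show ?thesis
    by (simp add: fundamental_field_def tangent_map_def action_0 origin_def)
qed

lemma from_coords_local_field:
  assumes "c \<in> A" "y \<in> chart_image c"
  shows "from_coords A c (chart_inv c y) (local_field c v y) = fundamental_field B A \<rho> v (chart_inv c y)"
proof -
  define x d b where "x = chart_inv c y" and "d = chart_at A x" and "b = chart_at B 0"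
  define \<phi> where "\<phi> = (\<lambda>t. \<rho> t x) \<circ> chart_inv b"
  have \<phi>: "\<phi> origin = x" by (simp add: \<phi>_def b_def origin action_0)
  have x: "x \<in> fst c" "snd c x = y" unfolding x_def using chart_inv_in[OF assms(2)] chart_chart_inv[OF assms(2)] by simp_all
  have d: "d \<in> A" "x \<in> fst d" by (simp_all add: d_def A.chart_at)
  have "continuous_on UNIV (\<lambda>t. (t, x))" by (intro continuous_intros)
  from continuous_on_compose2[OF continuous_action this]
  have "continuous_on UNIV (\<lambda>t. \<rho> t x)" by simp
  then have cont: "isCont \<phi> origin"
    using isCont_chart_inv[OF is_chart_B origin(1)] unfolding \<phi>_def b_def
    by (intro continuous_at_compose) (auto simp: continuous_on_eq_continuous_at)
  have "((snd d \<circ> \<phi>) has_derivative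
     (\<lambda>u. D (snd d \<circ> chart_inv c) (snd c (\<phi> origin)) (D (snd c \<circ> \<phi>) origin u))) (at origin)"
    using has_derivative_through_chart[OF A.chart[OF assms(1)] cont, of "snd d"] \<phi> x
      orbit_differentiable[OF assms] A.transition_differentiable[OF assms(1) d(1) x(1) d(2)]
    by (simp add: \<phi>_def b_def x_def o_assoc)
  from D_eqI[OF this] show ?thesis
    using local_field_eq_D[OF assms, of v] \<phi>
    by (simp add: fundamental_field_def tangent_map_def action_0 from_coords_def o_assoc
        flip: x_def origin_def)
      (simp add: \<phi>_def o_assoc b_def d_def flip: origin_def)
qed

section \<open>Infinitesimal invariance of forms\<close>

lemma tangent_map_local_action:
  assumes "c \<in> A" "(p, y) \<in> action_domain c"
  defines "t \<equiv> chart_inv (chart_at B 0) p"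
  shows "from_coords A c (\<rho> t (chart_inv c y)) (D (local_action c) (p, y) (0, u))
    = tangent_map A A (\<rho> t) (chart_inv c y) (from_coords A c (chart_inv c y) u)"
proof -
  have y: "y \<in> chart_image c" "\<rho> t (chart_inv c y) \<in> fst c"
    using assms(2) by (auto simp: action_domain_def t_def)
  have "((snd c \<circ> \<rho> t \<circ> chart_inv c) has_derivative (\<lambda>u. D (local_action c) (p, y) (0, u))) (at y)"
    using has_derivative_slice[OF local_action_differentiable[OF assms(1,2)]]
    by (simp add: local_action_def o_def t_def)
  from D_eqI[OF this] show ?thesis
    using tangent_map_from_coords(2)[OF A.smooth_manifold_axioms A.smooth_manifold_axioms
        smooth_translation[of t] assms(1) chart_inv_in[OF y(1)] assms(1) y(2), of u]
    by (simp add: chart_chart_inv[OF y(1)])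
qed

text \<open>Near the neutral element the pulled-back form, evaluated at \<open>y\<close> on fixed
  \<open>u\<close> and \<open>w\<close>, does not depend on the group coordinate. Its derivative at
  \<open>origin\<close> in direction \<open>v\<close> is the Lie derivative along
  \<open>V\<close>.\<close>

lemma lie_derivative_zero:
  fixes v :: 'k
  assumes c: "c \<in> A" and y: "y \<in> chart_image c"
    and "bilinear_field (chart_image c) (local_bilinear A c \<omega>)" and inv: "invariant_form A \<rho> \<omega>"
  defines "\<Omega> \<equiv> local_bilinear A c \<omega>" and "V \<equiv> local_field c v"
  shows "D (\<lambda>z. \<Omega> z u w) y (V y) + \<Omega> y (D V y u) w + \<Omega> y u (D V y w) = 0"
proof -
  interpret bilinear_field "chart_image c" \<Omega> using assms(3) by (simp add: \<Omega>_def)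
  let ?F = "local_action c"
  note dom = origin_in_action_domain[OF c y]
  note F_diff = local_action_differentiable[OF c]
  have F_origin: "?F (origin, z) = z" if "z \<in> chart_image c" for z
    using that by (simp add: local_action_def origin action_0 chart_chart_inv)
  have D_origin: "D ?F (origin, y) (0, u) = u" for u
  proof -
    have "((\<lambda>z. z) has_derivative (\<lambda>u. D ?F (origin, y) (0, u))) (at y)"
      by (rule has_derivative_transform_within_open[OF has_derivative_slice[OF F_diff[OF dom]]
            open_chart_image[OF A.chart[OF c]] y]) (rule F_origin)
    from has_derivative_unique[OF this has_derivative_ident] show ?thesis by metis
  qed
  have C2: "Ck_on 2 (action_domain c) ?F"
    using smooth_local_action[OF c] by (simp add: smooth_on_def)
  have diff2: "(\<lambda>q. D ?F q a) differentiable (at (origin, y))" for a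
    using smooth_on_differentiable[OF smooth_on_D[OF smooth_local_action[OF c]] dom] .
  have 0: "((\<lambda>p. ?F (p, y)) has_derivative (\<lambda>v. D ?F (origin, y) (v, 0))) (at origin)"
    by (rule has_derivative_slice_left[OF F_diff[OF dom]])
  have 1: "((\<lambda>p. D ?F (p, y) (0, u)) has_derivative
      (\<lambda>v. D (\<lambda>q. D ?F q (0, u)) (origin, y) (v, 0))) (at origin)" for u
    by (rule has_derivative_slice_left[OF diff2])
  \<comment> \<open>\<open>V\<close> differentiates first in the group and then in the manifold,
    while the pull-back produces the opposite order; symmetry of the second derivative identifies
    them.\<close>
  have 2: "D V y u = D (\<lambda>q. D ?F q (0, u)) (origin, y) (v, 0)" for u
  proof -
    have "(V has_derivative (\<lambda>u. D (\<lambda>q. D ?F q (v, 0)) (origin, y) (0, u))) (at y)"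
      unfolding V_def local_field_def[abs_def] by (rule has_derivative_slice[OF diff2])
    from D_eqI[OF this] show ?thesis
      using D_D_commute[OF open_action_domain[OF c] dom C2, of "(v, 0)" "(0, u)"] by simp
  qed
  have const: "\<Omega> (?F (p, y)) (D ?F (p, y) (0, u)) (D ?F (p, y) (0, w)) = \<Omega> y u w"
    if p: "(p, y) \<in> action_domain c" for p
  proof -
    have "chart_inv c (?F (p, y)) = \<rho> (chart_inv (chart_at B 0) p) (chart_inv c y)"
      using p chart_inv_chart[OF A.chart[OF c]] by (auto simp: local_action_def action_domain_def)
    then show ?thesis
      using inv by (simp add: \<Omega>_def local_bilinear_def Let_def tangent_map_local_action[OF c p] invariant_form_def)
  qed
  define N where "N = (\<lambda>p. (p, y)) -` action_domain c"
  have N: "open N" "origin \<in> N"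
    using dom open_action_domain[OF c] unfolding N_def
    by (auto intro!: open_vimage continuous_intros)
  have "((\<lambda>_. \<Omega> y u w) has_derivative (\<lambda>h. D (\<lambda>z. \<Omega> z u w) y (D ?F (origin, y) (h, 0))
      + \<Omega> y (D (\<lambda>q. D ?F q (0, u)) (origin, y) (h, 0)) w
      + \<Omega> y u (D (\<lambda>q. D ?F q (0, w)) (origin, y) (h, 0)))) (at origin)"
  proof (rule has_derivative_transform_within_open[OF _ N])
    show "((\<lambda>p. \<Omega> (?F (p, y)) (D ?F (p, y) (0, u)) (D ?F (p, y) (0, w))) has_derivative
      (\<lambda>h. D (\<lambda>z. \<Omega> z u w) y (D ?F (origin, y) (h, 0))
      + \<Omega> y (D (\<lambda>q. D ?F q (0, u)) (origin, y) (h, 0)) w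
      + \<Omega> y u (D (\<lambda>q. D ?F q (0, w)) (origin, y) (h, 0)))) (at origin)"
      using has_derivative_along[of "\<lambda>p. ?F (p, y)" origin "\<lambda>p. D ?F (p, y) (0, u)" "\<lambda>p. D ?F (p, y) (0, w)"]
      by (simp add: F_origin y D_origin D_eqI[OF 0] D_eqI[OF 1] differentiableI[OF 0] differentiableI[OF 1])
    show "\<Omega> (?F (p, y)) (D ?F (p, y) (0, u)) (D ?F (p, y) (0, w)) = \<Omega> y u w" if "p \<in> N" for p
      using that const by (simp add: N_def)
  qed
  from fun_cong[OF has_derivative_unique[OF this has_derivative_const], of v] show ?thesis
    unfolding 2 by (simp add: V_def local_field_def)
qed

lemma closed_contraction:
  assumes "closed_2form A \<omega>" "invariant_form A \<rho> \<omega>"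
  shows "closed_1form A (\<lambda>x w. \<omega> x (fundamental_field B A \<rho> v x) w)"
    (is "closed_1form A ?\<alpha>")
proof -
  have \<alpha>: "local_1form A c ?\<alpha> y w = local_bilinear A c \<omega> y (local_field c v y) w"
    if "c \<in> A" "y \<in> chart_image c" for c y w
    using from_coords_local_field[OF that] by (simp add: local_1form_def local_bilinear_def Let_def)
  have bil: "bilinear (\<omega> x)" for x
    using assms(1) by (simp add: closed_2form_def)
  have smooth: "smooth_on (chart_image c) (\<lambda>y. local_bilinear A c \<omega> y u w)" if "c \<in> A" for c u w
    using assms(1) that unfolding closed_2form_def by blast
  have field: "bilinear_field (chart_image c) (local_bilinear A c \<omega>)" if "c \<in> A" for c
    by (rule A.smooth_bilinear_field[OF that bil smooth[OF that]])
  show ?thesis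
    unfolding closed_1form_def
  proof (intro conjI ballI allI)
    show "linear (?\<alpha> x)" for x
      using bil[of x] by (simp add: bilinear_def)
  next
    fix c w assume c: "c \<in> A"
    interpret bilinear_field "chart_image c" "local_bilinear A c \<omega>" by (rule field[OF c])
    show "smooth_on (chart_image c) (\<lambda>y. local_1form A c ?\<alpha> y w)"
    proof (rule smooth_on_cong[OF open_S])
      \<comment> \<open>Smoothness of the form is known for constant arguments only, hence the
        expansion of the field in the basis.\<close>
      show "smooth_on (chart_image c) (\<lambda>y. \<Sum>i\<in>Basis. (local_field c v y \<bullet> i) * local_bilinear A c \<omega> y i w)"
        by (intro smooth_on_sum smooth_on_mult open_S
            smooth_on_linear[OF _ bounded_linear_inner_left] smooth_local_field smooth c)
      fix y assume y: "y \<in> chart_image c"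
      have lin: "linear (\<lambda>u. local_bilinear A c \<omega> y u w)" using bilin[OF y] by (simp add: bilinear_def)
      have "local_bilinear A c \<omega> y (\<Sum>i\<in>Basis. (local_field c v y \<bullet> i) *\<^sub>R i) w
          = (\<Sum>i\<in>Basis. (local_field c v y \<bullet> i) * local_bilinear A c \<omega> y i w)"
        by (simp add: linear_sum[OF lin] linear_cmul[OF lin])
      then show "(\<Sum>i\<in>Basis. (local_field c v y \<bullet> i) * local_bilinear A c \<omega> y i w) = local_1form A c ?\<alpha> y w"
        by (simp add: \<alpha>[OF c y] euclidean_representation)
    qed
  next
    fix c y u w assume c: "c \<in> A" and y: "y \<in> chart_image c"
    interpret bilinear_field "chart_image c" "local_bilinear A c \<omega>" by (rule field[OF c])
    let ?\<Omega> = "local_bilinear A c \<omega>" and ?V = "local_field c v"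
    have V: "?V differentiable (at y)"
      by (rule smooth_on_differentiable[OF smooth_local_field[OF c] y])
    have D_\<alpha>: "D (\<lambda>y. local_1form A c ?\<alpha> y w) y = D (\<lambda>z. ?\<Omega> z (?V z) w) y" for w
      by (rule frechet_derivative_transform_within_open[OF D_contract(2)[OF y V] open_S y, symmetric])
        (simp add: \<alpha> c)
    have skew: "?\<Omega> z u w = - ?\<Omega> z w u" for z u w
      using assms(1) unfolding closed_2form_def local_bilinear_def Let_def by metis
    have "D (\<lambda>z. ?\<Omega> z v w) y u + D (\<lambda>z. ?\<Omega> z w u) y v + D (\<lambda>z. ?\<Omega> z u v) y w = 0" for u v w
      using assms(1) c y unfolding closed_2form_def by blast
    then have "D (\<lambda>z. ?\<Omega> z (?V z) w) y u - D (\<lambda>z. ?\<Omega> z (?V z) u) y w = 0"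
      using lie_derivative_zero[OF c y field[OF c] assms(2), of u w v] cartan[OF y V skew, of w u]
      by simp
    then show "D (\<lambda>y. local_1form A c ?\<alpha> y w) y u = D (\<lambda>y. local_1form A c ?\<alpha> y u) y w"
      by (simp add: D_\<alpha>)
  qed
qed

end

section \<open>Moment maps on hyper-Kaehler manifolds\<close>

context action_on_manifold
begin

lemma moment_map_exists:
  assumes "first_betti_number A = 0" "closed_2form A \<omega>" "invariant_form A \<rho> \<omega>"
  shows "\<exists>\<phi>. moment_map B A \<omega> \<rho> \<phi>"
proof -
  let ?V = "fundamental_field B A \<rho>"
  have "\<exists>f. smooth_fun A f \<and> (\<lambda>x w. \<omega> x (?V v x) w) = differential A f" for v
    using A.closed_1form_exact[OF assms(1) closed_contraction[OF assms(2,3)]]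
    by (simp add: exact_1form_def)
  then obtain f where smooth: "\<And>v. smooth_fun A (f v)"
    and f: "\<And>v. (\<lambda>x w. \<omega> x (?V v x) w) = differential A (f v)" by metis
  \<comment> \<open>The Hamiltonians chosen for different \<open>v\<close> carry unrelated additive
    constants and need not depend linearly on \<open>v\<close>. Only those of basis vectors are kept
    and extended linearly; linearity of \<open>fundamental_field\<close> in \<open>v\<close> keeps
    the result Hamiltonian.\<close>
  define \<phi> where "\<phi> x = Blinfun (\<lambda>v. \<Sum>b\<in>Basis. (v \<bullet> b) * f b x)" for x
  have \<phi>: "blinfun_apply (\<phi> x) v = (\<Sum>b\<in>Basis. (v \<bullet> b) * f b x)" for x v
    unfolding \<phi>_def
    by (subst bounded_linear_Blinfun_apply)
      (intro bounded_linear_sum bounded_linear_mult_const bounded_linear_inner_left, rule refl)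
  have "differential A (\<lambda>x. \<Sum>b\<in>Basis. (v \<bullet> b) * f b x) x w = \<omega> x (?V v x) w" for v x w
  proof -
    have "bilinear (\<omega> x)"
      using assms(2) unfolding closed_2form_def by blast
    then have l: "linear (\<lambda>v. \<omega> x v w)"
      by (simp add: bilinear_def)
    have "?V (\<Sum>b\<in>Basis. (v \<bullet> b) *\<^sub>R b) x = (\<Sum>b\<in>Basis. (v \<bullet> b) *\<^sub>R ?V b x)"
      by (simp add: linear_sum[OF linear_fundamental_field] linear_cmul[OF linear_fundamental_field])
    then have "?V v x = (\<Sum>b\<in>Basis. (v \<bullet> b) *\<^sub>R ?V b x)"
      by (simp add: euclidean_representation)
    then have "\<omega> x (?V v x) w = (\<Sum>b\<in>Basis. (v \<bullet> b) * \<omega> x (?V b x) w)"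
      by (simp add: linear_sum[OF l] linear_cmul[OF l])
    then show ?thesis
      by (simp add: A.differential_sum(2) smooth fun_cong[OF fun_cong[OF f]])
  qed
  then have "moment_map B A \<omega> \<rho> \<phi>"
    by (simp add: moment_map_def hamiltonian_def \<phi> A.differential_sum(1) smooth)
  then show ?thesis by blast
qed

lemma kaehler_local_endo:
  assumes "c \<in> A" "kaehler_structure A g J" "y \<in> chart_image c"
  shows "linear (local_endo A c J y)" "local_endo A c J y (local_endo A c J y w) = - w"
    "(\<lambda>z. local_endo A c J z w) differentiable (at y)"
    "(\<lambda>z. local_endo A c J z (local_field c v z)) differentiable (at y)"
proof -
  have J: "linear (J x)" "J x (J x w) = - w" for x w
    using assms(2) by (auto simp: kaehler_structure_def complex_structure_def)
  have lin: "linear (local_endo A c J y)" if "y \<in> chart_image c" for y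
    by (rule A.linear_local_endo[OF assms(1) that J(1)])
  show "linear (local_endo A c J y)" by (rule lin[OF assms(3)])
  have "linear (to_coords A c (chart_inv c y))" "linear (from_coords A c (chart_inv c y))"
    by (simp_all only: A.linear_to_coords A.linear_from_coords assms(1) chart_inv_in[OF assms(3)])
  then show "local_endo A c J y (local_endo A c J y w) = - w"
    unfolding A.local_endo_compose[OF assms(1,3)]
    by (simp add: local_endo_def Let_def J linear_neg A.to_from_coords[OF assms(1) chart_inv_in[OF assms(3)]])
  have diff: "(\<lambda>z. local_endo A c J z w) differentiable (at y)" for w
    by (rule smooth_on_differentiable[OF _ assms(3)])
      (use assms(1,2) in \<open>simp add: kaehler_structure_def complex_structure_def\<close>)
  show "(\<lambda>z. local_endo A c J z w) differentiable (at y)" by (rule diff)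
  show "(\<lambda>z. local_endo A c J z (local_field c v z)) differentiable (at y)"
    by (rule endo_field_differentiable[OF open_chart_image[OF A.chart[OF assms(1)]] assms(3) lin diff
        smooth_on_differentiable[OF smooth_local_field[OF assms(1)] assms(3)]])
qed

(* K (J V) is -L V, so J V is a symplectic vector field for the Kaehler form of K as soon as V is
   one for that of L. *)
lemma divergence_rotated_field:
  assumes c: "c \<in> A" and y: "y \<in> chart_image c"
    and J: "kaehler_structure A g J" and K: "kaehler_structure A g K" and L: "kaehler_structure A g L"
    and KJ: "\<And>x v. K x (J x v) = - L x v"
    and inv: "invariant_form A \<rho> (kaehler_form g L)"
  shows "local_divergence (local_bilinear A c g) (\<lambda>z. local_endo A c J z (local_field c v z)) y = 0"
proof -
  let ?G = "local_bilinear A c g" and ?K = "local_endo A c K"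
    and ?X = "\<lambda>z. local_endo A c J z (local_field c v z)"
    and ?\<alpha> = "local_1form A c (\<lambda>x w. kaehler_form g L x (fundamental_field B A \<rho> v x) w)"
  interpret local_metric "chart_image c" ?G
    by (rule A.riemannian_local_metric[OF c]) (use J in \<open>simp add: kaehler_structure_def\<close>)
  note \<omega>K = A.local_bilinear_kaehler_form[OF c, where g = g and J = K, symmetric]
  have closed_K: "closed_2form A (kaehler_form g K)" and closed_L: "closed_2form A (kaehler_form g L)"
    using K L by (auto simp: kaehler_structure_def)
  have closed_\<alpha>: "closed_1form A (\<lambda>x w. kaehler_form g L x (fundamental_field B A \<rho> v x) w)"
    by (rule closed_contraction[OF closed_L inv])
  have skew_K: "kaehler_form g K x u w = - kaehler_form g K x w u" for x u w
    using closed_K unfolding closed_2form_def by blast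
  have K_diff: "(\<lambda>z. ?G z (?K z u) w) differentiable (at y)"  for u w
    by (rule D_contract(2)[OF y kaehler_local_endo(3)[OF c K y]])
  have \<omega>_D: "D (\<lambda>z. ?G z (?K z u) w) y = D (\<lambda>z. local_bilinear A c (kaehler_form g K) z u w) y" for u w
    by (rule frechet_derivative_transform_within_open[OF K_diff open_S y]) (rule \<omega>K)
  have \<alpha>: "?G z (?K z (?X z)) w = - ?\<alpha> z w" if z: "z \<in> chart_image c" for z w
  proof -
    have "?K z (?X z) = local_endo A c (\<lambda>x v. - L x v) z (local_field c v z)"
      by (simp add: A.local_endo_compose[OF c z] KJ)
    then have "?G z (?K z (?X z)) w = local_bilinear A c (kaehler_form g (\<lambda>x v. - L x v)) z (local_field c v z) w"
      by (simp add: A.local_bilinear_kaehler_form[OF c z])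
    also have "\<dots> = kaehler_form g (\<lambda>x v. - L x v) (chart_inv c z) (fundamental_field B A \<rho> v (chart_inv c z))
        (from_coords A c (chart_inv c z) w)"
      by (simp add: local_bilinear_def Let_def from_coords_local_field[OF c z])
    also have "\<dots> = - ?\<alpha> z w"
    proof -
      have "bilinear (g x)" for x
        using J by (simp add: kaehler_structure_def riemannian_metric_def)
      then show ?thesis by (simp add: kaehler_form_def local_1form_def Let_def bilinear_lneg)
    qed
    finally show ?thesis .
  qed
  have \<alpha>_diff: "(\<lambda>z. ?\<alpha> z w) differentiable (at y)" for w
    using closed_\<alpha> c y by (intro smooth_on_differentiable[of "chart_image c"]) (auto simp: closed_1form_def)
  have D_\<alpha>: "D (\<lambda>z. ?G z (?K z (?X z)) w) y u = - D (\<lambda>z. ?\<alpha> z w) y u" for u w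
  proof -
    have "((\<lambda>z. ?G z (?K z (?X z)) w) has_derivative (\<lambda>u. - D (\<lambda>z. ?\<alpha> z w) y u)) (at y)"
      by (rule has_derivative_transform_within_open[OF has_derivative_minus[OF has_D[OF \<alpha>_diff]] open_S y])
        (rule \<alpha>[symmetric])
    from D_eqI[OF this] show ?thesis by simp
  qed
  show ?thesis
  proof (rule divergence_symplectic[OF y, where K = ?K])
    show "linear (?K z)" "?K z (?K z u) = - u" "(\<lambda>z. ?K z u) differentiable (at z)"
      if "z \<in> chart_image c" for z u
      by (rule kaehler_local_endo[OF c K that])+
    show "?G z (?K z u) w = - ?G z (?K z w) u" if z: "z \<in> chart_image c" for z u w
      unfolding \<omega>K[OF z] unfolding local_bilinear_def Let_def by (rule skew_K)
    show "D (\<lambda>z. ?G z (?K z v) w) y u + D (\<lambda>z. ?G z (?K z w) u) y v + D (\<lambda>z. ?G z (?K z u) v) y w = 0" for u v w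
      using closed_K c y unfolding \<omega>_D closed_2form_def by blast
    show "?X differentiable (at y)" by (rule kaehler_local_endo(4)[OF c J y])
    show "D (\<lambda>z. ?G z (?K z (?X z)) w) y u = D (\<lambda>z. ?G z (?K z (?X z)) u) y w" for u w
      using closed_\<alpha> c y unfolding D_\<alpha> closed_1form_def neg_equal_iff_equal by blast
  qed
qed

lemma harmonic_hamiltonian:
  assumes hk: "hyper_kaehler A g J1 J2 J3" and J: "admissible A g J1 J2 J3 J"
    and inv: "invariant_form A \<rho> (kaehler_form g J1)" "invariant_form A \<rho> (kaehler_form g J2)"
      "invariant_form A \<rho> (kaehler_form g J3)"
    and f: "hamiltonian A (kaehler_form g J) (fundamental_field B A \<rho> v) f"
  shows "harmonic_fun A g f"
  unfolding harmonic_fun_def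
proof (intro conjI ballI)
  show smooth: "smooth_fun A f" using f by (simp add: hamiltonian_def)
  fix c y assume c: "c \<in> A" and y: "y \<in> chart_image c"
  let ?G = "local_bilinear A c g" and ?V = "local_field c v"
  have Js: "kaehler_structure A g J1" "kaehler_structure A g J2" "kaehler_structure A g J3"
    "J1 x (J2 x w) = J3 x w" "J3 x w = - J2 x (J1 x w)" for x w
    using hk by (auto simp: hyper_kaehler_def)
  have metric: "riemannian_metric A g" using Js(1) by (simp add: kaehler_structure_def)
  interpret local_metric "chart_image c" ?G by (rule A.riemannian_local_metric[OF c metric])
  obtain q :: "real ^ 3" where
    q: "\<And>x v. J x v = (q $ 1) *\<^sub>R J1 x v + (q $ 2) *\<^sub>R J2 x v + (q $ 3) *\<^sub>R J3 x v"
    using J by (auto simp: admissible_def)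
  \<comment> \<open>Indexing by the type \<open>3\<close> matches the components of
    \<open>q\<close>, so that the admissible structure is a sum over \<open>UNIV\<close>.\<close>
  define K where "K i = (if i = 1 then J1 else if i = 2 then J2 else J3)" for i :: 3
  have K: "K 1 = J1" "K 2 = J2" "K 3 = J3" by (simp_all add: K_def)
  let ?X = "\<lambda>i z. local_endo A c (K i) z (?V z)"
  have kK: "kaehler_structure A g (K i)" for i
    using Js by (simp add: K_def)
  have gradient: "local_gradient ?G (f \<circ> chart_inv c) z = (\<Sum>i\<in>UNIV. (q $ i) *\<^sub>R ?X i z)"
    if z: "z \<in> chart_image c" for z
  proof -
    interpret G: inner_form "?G z" by (rule inner_form[OF z])
    have "D (f \<circ> chart_inv c) z w = ?G z (local_endo A c J z (?V z)) w" for w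
      using A.differential_from_coords[OF smooth c chart_inv_in[OF z], of w] f
        A.local_bilinear_kaehler_form[OF c z, of g J "?V z" w]
      by (simp add: chart_chart_inv[OF z] hamiltonian_def local_bilinear_def Let_def
          from_coords_local_field[OF c z])
    then have "local_gradient ?G (f \<circ> chart_inv c) z = local_endo A c J z (?V z)"
      unfolding local_gradient_def by (intro the_equality) (auto intro: G.eqI)
    also have "\<dots> = (\<Sum>i\<in>UNIV. (q $ i) *\<^sub>R ?X i z)"
    proof -
      have "linear (to_coords A c (chart_inv c z))"
        by (rule A.linear_to_coords[OF c chart_inv_in[OF z]])
      then show ?thesis
        by (simp add: sum_3 K local_endo_def Let_def q linear_add linear_cmul)
    qed
    finally show ?thesis .
  qed
  have X_diff: "?X i differentiable (at y)" for i by (rule kaehler_local_endo(4)[OF c kK y])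
  have J_1: "J1 x (J1 x w) = - w" and J_2: "J2 x (J2 x w) = - w" for x w
    using Js(1,2) by (auto simp: kaehler_structure_def complex_structure_def)
  have lin: "linear (J1 x)" for x
    using Js(1) by (auto simp: kaehler_structure_def complex_structure_def)
  \<comment> \<open>The last two relations come from J3 = J1 J2 by cancelling a square: J3 J2 = J1
    J2 J2 and J1 J3 = J1 J1 J2.\<close>
  have rot: "J2 x (J1 x w) = - J3 x w" "J3 x (J2 x w) = - J1 x w" "J1 x (J3 x w) = - J2 x w" for x w
    by (simp add: Js(5))
      (metis Js(4) J_2 lin(1) linear_neg, metis Js(4) J_1)
  have "local_divergence ?G (?X i) y = 0" for i
    using exhaust_3[of i] divergence_rotated_field[OF c y Js(1,2,3) rot(1) inv(3)]
      divergence_rotated_field[OF c y Js(2,3,1) rot(2) inv(1)]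
      divergence_rotated_field[OF c y Js(3,1,2) rot(3) inv(2)]
    by (auto simp: K)
  then have "local_divergence ?G (\<lambda>z. \<Sum>i\<in>UNIV. (q $ i) *\<^sub>R ?X i z) y = 0"
    by (simp add: local_divergence_sum[OF y X_diff])
  \<comment> \<open>The formula for the gradient holds only on the image of the chart. The
    divergence uses the value and the derivative at \<open>y\<close>, and both carry over because
    that image is open.\<close>
  moreover have "(\<lambda>z. \<Sum>i\<in>UNIV. (q $ i) *\<^sub>R ?X i z) differentiable (at y)"
    by (simp add: X_diff)
  from frechet_derivative_transform_within_open[OF this open_S y gradient[symmetric]]
  have "D (\<lambda>z. \<Sum>i\<in>UNIV. (q $ i) *\<^sub>R ?X i z) y = D (local_gradient ?G (f \<circ> chart_inv c)) y" .
  ultimately show "local_laplacian ?G (f \<circ> chart_inv c) y = 0"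
    by (simp add: local_laplacian_def local_divergence_def gradient[OF y])
qed

lemma invariant_kaehler_form:
  assumes "\<And>t. riemannian_isometry A g (\<rho> t)" "\<And>t. holomorphic_map A J (\<rho> t)"
  shows "invariant_form A \<rho> (kaehler_form g J)"
proof -
  have "J (\<rho> t x) (tangent_map A A (\<rho> t) x v) = tangent_map A A (\<rho> t) x (J x v)" for t x v
    using assms(2) by (simp add: holomorphic_map_def)
  then show ?thesis
    using assms(1) by (simp add: invariant_form_def kaehler_form_def riemannian_isometry_def)
qed

end

theorem proposition3p1:
  fixes A :: "('m::{second_countable_topology,t2_space}, 'e::euclidean_space) chart set"
    and g :: "'m \<Rightarrow> 'e \<Rightarrow> 'e \<Rightarrow> real"
    and J1 J2 J3 J :: "'m \<Rightarrow> 'e \<Rightarrow> 'e"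
    and B :: "('t::{ab_group_add,second_countable_topology,t2_space}, 'k::euclidean_space) chart set"
    and \<rho> :: "'t \<Rightarrow> 'm \<Rightarrow> 'm"
  assumes "smooth_atlas A"
    and "connected (UNIV :: 'm set)"
    and "hyper_kaehler A g J1 J2 J3"
    and "first_betti_number A = 0"
    and "abelian_lie_group B"
    and "connected (UNIV :: 't set)"
    and "smooth_action B A \<rho>"
    and "nontrivial_action \<rho>"
    and "\<And>t. triholomorphic_isometry A g J1 J2 J3 (\<rho> t)"
    and "admissible A g J1 J2 J3 J"
  shows "(\<exists>\<phi>. moment_map B A (kaehler_form g J) \<rho> \<phi>) \<and>
         (\<forall>\<phi>. moment_map B A (kaehler_form g J) \<rho> \<phi> \<longrightarrow> harmonic_map A g \<phi>)"
proof -
  interpret action_on_manifold A B \<rho>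
    using assms(1,5,7,9)
    by unfold_locales (auto simp: abelian_lie_group_def triholomorphic_isometry_def riemannian_isometry_def)
  have iso: "riemannian_isometry A g (\<rho> t)" "holomorphic_map A J1 (\<rho> t)"
    "holomorphic_map A J2 (\<rho> t)" "holomorphic_map A J3 (\<rho> t)" for t
    using assms(9)[of t] by (auto simp: triholomorphic_isometry_def)
  note inv = invariant_kaehler_form[OF iso(1)]
  obtain q :: "real ^ 3" where
    q: "\<And>x v. J x v = (q $ 1) *\<^sub>R J1 x v + (q $ 2) *\<^sub>R J2 x v + (q $ 3) *\<^sub>R J3 x v"
    using assms(10) by (auto simp: admissible_def)
  \<comment> \<open>Commutation with the three basic structures passes to their combination
    \<open>J\<close> only through linearity of the tangent map.\<close>
  have "linear (tangent_map A A (\<rho> t) x)" for t x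
    unfolding tangent_map_def
    using tangent_map_from_coords(1)[OF A.smooth_manifold_axioms A.smooth_manifold_axioms
        smooth_translation A.chart_at A.chart_at]
    by (rule linear_frechet_derivative)
  then have "holomorphic_map A J (\<rho> t)" for t
    using iso(2-4)[of t] by (simp add: holomorphic_map_def q linear_add linear_cmul)
  then have "invariant_form A \<rho> (kaehler_form g J)"
    by (rule inv)
  moreover have "closed_2form A (kaehler_form g J)"
    using assms(10) by (simp add: admissible_def kaehler_structure_def)
  ultimately have "\<exists>\<phi>. moment_map B A (kaehler_form g J) \<rho> \<phi>"
    using moment_map_exists assms(4) by blast
  moreover have "harmonic_map A g \<phi>" if "moment_map B A (kaehler_form g J) \<rho> \<phi>" for \<phi>
    using that harmonic_hamiltonian[OF assms(3,10) inv[OF iso(2)] inv[OF iso(3)] inv[OF iso(4)]]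
    unfolding moment_map_def harmonic_map_def by blast
  ultimately show ?thesis by blast
qed

end
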